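(* Let $m \ge 1$, $n\ge 1$ and let $\mathbb{F}$ be a coefficient ring. Define the subcomplex \[ \Gamma_{m,n} = \{\sigma \in \mathsf{M}_{m,n} : s\bar{1} \notin \sigma \text{ for all } s \in [3,m]\} \] of $\mathsf{M}_{m,n}$. For each $d$ put \[ \hat{P}^{m-1,n-1}_{d} = \bigoplus_{s=3}^m \tilde{H}_{d}(\mathsf{M}_{[m]\setminus \{s\},[2,n]};\mathbb{F}), \] where the summand indexed by $s$ is thought of as $s\bar{1}\otimes \tilde{H}_{d}(\mathsf{M}_{[m]\setminus \{s\},[2,n]};\mathbb{F})$. Then there is a long exact sequence \[ \cdots \to \hat{P}^{m-1,n-1}_{d} \to \tilde{H}_{d}(\Gamma_{m,n};\mathbb{F}) \to \tilde{H}_{d}(\mathsf{M}_{m,n};\mathbb{F}) \to \hat{P}^{m-1,n-1}_{d-1} \to \tilde{H}_{d-1}(\Gamma_{m,n};\mathbb{F}) \to \cdots . \]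
   Context: $K_{m,n}$ is the complete bipartite graph with vertex blocks $[m]=\{1,\dots,m\}$ and $[\bar n]=\{\bar 1,\dots,\bar n\}$ (a disjoint copy of $[n]$). Its edges are written $i\bar{j}$. For finite sets $S\subseteq[m]$ and $T\subseteq[n]$, $\mathsf{M}_{S,T}$ is the simplicial complex of matchings (sets of pairwise vertex-disjoint edges) in the complete bipartite graph with blocks $S$ and $\bar T$. $\mathsf{M}_{m,n}=\mathsf{M}_{[m],[n]}$. For integers $a\le b$, $[a,b]=\{a,\dots,b\}$. Homology is reduced simplicial homology. *)

theory Defs
  imports "HOL-Algebra.Module" "HOL-Algebra.AbelCoset" "HOL-Library.Product_Lexorder"
begin

section \<open>Modules\<close>

text \<open>
  The modules below are left modules over an arbitrary unital ring, carried by the record type of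
  \<^theory>\<open>HOL-Algebra.Module\<close>; the locale there is not used because it forces the scalars to
  commute. That record extends rings; its multiplicative fields play no role for modules and are
  left unspecified.
\<close>

definition free_module :: "('a, 'r) ring_scheme \<Rightarrow> 'x set \<Rightarrow> ('a, 'x \<Rightarrow> 'a) module" where
  "free_module R X = \<lparr>
     carrier = {c. (\<forall>x\<in>X. c x \<in> carrier R) \<and> (\<forall>x. x \<notin> X \<longrightarrow> c x = \<zero>\<^bsub>R\<^esub>) \<and>
                   finite {x. c x \<noteq> \<zero>\<^bsub>R\<^esub>}},
     mult = undefined, one = undefined,
     zero = (\<lambda>x. \<zero>\<^bsub>R\<^esub>),
     add = (\<lambda>c d x. c x \<oplus>\<^bsub>R\<^esub> d x),
     smult = (\<lambda>r c x. r \<otimes>\<^bsub>R\<^esub> c x)\<rparr>"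

definition quotient_module ::
  "('a, 'b, 'm) module_scheme \<Rightarrow> 'b set \<Rightarrow> ('a, 'b set) module" where
  "quotient_module M N = \<lparr>
     carrier = a_rcosets\<^bsub>M\<^esub> N,
     mult = undefined, one = undefined,
     zero = N,
     add = (\<lambda>X Y. X <+>\<^bsub>M\<^esub> Y),
     smult = (\<lambda>r X. \<Union>x\<in>X. N +>\<^bsub>M\<^esub> (r \<odot>\<^bsub>M\<^esub> x))\<rparr>"

definition direct_sum ::
  "'i set \<Rightarrow> ('i \<Rightarrow> ('a, 'b, 'm) module_scheme) \<Rightarrow> ('a, 'i \<Rightarrow> 'b) module" where
  "direct_sum I M = \<lparr>
     carrier = {f \<in> \<Pi>\<^sub>E i\<in>I. carrier (M i). finite {i\<in>I. f i \<noteq> \<zero>\<^bsub>M i\<^esub>}},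
     mult = undefined, one = undefined,
     zero = (\<lambda>i\<in>I. \<zero>\<^bsub>M i\<^esub>),
     add = (\<lambda>f g. \<lambda>i\<in>I. f i \<oplus>\<^bsub>M i\<^esub> g i),
     smult = (\<lambda>r f. \<lambda>i\<in>I. r \<odot>\<^bsub>M i\<^esub> f i)\<rparr>"

definition linear_maps ::
  "('a, 'r) ring_scheme \<Rightarrow> ('a, 'b, 'm) module_scheme \<Rightarrow> ('a, 'c, 'n) module_scheme \<Rightarrow> ('b \<Rightarrow> 'c) set"
  where
  "linear_maps R M N = {f \<in> hom (add_monoid M) (add_monoid N).
     \<forall>r\<in>carrier R. \<forall>x\<in>carrier M. f (r \<odot>\<^bsub>M\<^esub> x) = r \<odot>\<^bsub>N\<^esub> f x}"

text \<open>Exactness, at every term and in all integer degrees, of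
  \<open>\<dots> \<rightarrow> A d \<rightarrow> B d \<rightarrow> C d \<rightarrow> A (d - 1) \<rightarrow> B (d - 1) \<rightarrow> \<dots>\<close>\<close>

definition long_exact_sequence ::
  "('a, 'r) ring_scheme \<Rightarrow>
   (int \<Rightarrow> ('a, 'b, 'l) module_scheme) \<Rightarrow>
   (int \<Rightarrow> ('a, 'c, 'm) module_scheme) \<Rightarrow>
   (int \<Rightarrow> ('a, 'd, 'n) module_scheme) \<Rightarrow>
   (int \<Rightarrow> 'b \<Rightarrow> 'c) \<Rightarrow> (int \<Rightarrow> 'c \<Rightarrow> 'd) \<Rightarrow> (int \<Rightarrow> 'd \<Rightarrow> 'b) \<Rightarrow> bool" where
  "long_exact_sequence R A B C f g h \<longleftrightarrow> (\<forall>d.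
     f d \<in> linear_maps R (A d) (B d) \<and>
     g d \<in> linear_maps R (B d) (C d) \<and>
     h d \<in> linear_maps R (C d) (A (d - 1)) \<and>
     f d ` carrier (A d) = a_kernel (B d) (C d) (g d) \<and>
     g d ` carrier (B d) = a_kernel (C d) (A (d - 1)) (h d) \<and>
     h d ` carrier (C d) = a_kernel (A (d - 1)) (B (d - 1)) (f (d - 1)))"

section \<open>Reduced simplicial homology\<close>

text \<open>The empty face is a face of dimension \<open>-1\<close>.\<close>

definition simplicial_complex :: "'v set set \<Rightarrow> bool" where
  "simplicial_complex K \<longleftrightarrow>
     {} \<in> K \<and> (\<forall>\<sigma>\<in>K. finite \<sigma>) \<and> (\<forall>\<sigma>\<in>K. \<forall>\<tau>. \<tau> \<subseteq> \<sigma> \<longrightarrow> \<tau> \<in> K)"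

definition faces :: "'v set set \<Rightarrow> int \<Rightarrow> 'v set set" where
  "faces K d = {\<sigma>\<in>K. finite \<sigma> \<and> int (card \<sigma>) = d + 1}"

definition chains :: "('a, 'r) ring_scheme \<Rightarrow> 'v set set \<Rightarrow> int \<Rightarrow> ('a, 'v set \<Rightarrow> 'a) module" where
  "chains R K d = free_module R (faces K d)"

text \<open>
  Faces are oriented by the linear order on vertices. The value at \<open>\<tau>\<close> is the coefficient of \<open>\<tau>\<close>
  in \<open>\<Sum>\<^sub>\<sigma> \<Sum>\<^sub>v (-1)\<^sup>p c(\<sigma>) (\<sigma> - {v})\<close>, where \<open>v\<close> ranges over the vertices of \<open>\<sigma>\<close> and \<open>p\<close> is the
  position (from 0) of \<open>v\<close> in \<open>\<sigma>\<close>.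
\<close>

definition boundary ::
  "('a, 'r) ring_scheme \<Rightarrow> ('v::linorder set \<Rightarrow> 'a) \<Rightarrow> 'v set \<Rightarrow> 'a" where
  "boundary R c \<tau> =
     (\<Oplus>\<^bsub>R\<^esub>\<sigma>\<in>{\<sigma>. c \<sigma> \<noteq> \<zero>\<^bsub>R\<^esub>}. \<Oplus>\<^bsub>R\<^esub>v\<in>{v\<in>\<sigma>. \<sigma> - {v} = \<tau>}.
        (\<ominus>\<^bsub>R\<^esub> \<one>\<^bsub>R\<^esub>) [^]\<^bsub>R\<^esub> card {w\<in>\<sigma>. w < v} \<otimes>\<^bsub>R\<^esub> c \<sigma>)"

definition cycles ::
  "('a, 'r) ring_scheme \<Rightarrow> 'v::linorder set set \<Rightarrow> int \<Rightarrow> ('v set \<Rightarrow> 'a) set" where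
  "cycles R K d = a_kernel (chains R K d) (chains R K (d - 1)) (boundary R)"

definition boundaries ::
  "('a, 'r) ring_scheme \<Rightarrow> 'v::linorder set set \<Rightarrow> int \<Rightarrow> ('v set \<Rightarrow> 'a) set" where
  "boundaries R K d = boundary R ` carrier (chains R K (d + 1))"

definition reduced_homology ::
  "('a, 'r) ring_scheme \<Rightarrow> 'v::linorder set set \<Rightarrow> int \<Rightarrow> ('a, ('v set \<Rightarrow> 'a) set) module" where
  "reduced_homology R K d =
     quotient_module (chains R K d\<lparr>carrier := cycles R K d\<rparr>) (boundaries R K d)"

section \<open>Chessboard complexes\<close>

text \<open>The edge joining \<open>i\<close> in the first block to the copy of \<open>j\<close> in the second is the pair \<open>(i, j)\<close>;
  the sum type makes the two blocks disjoint.\<close>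

fun ends :: "nat \<times> nat \<Rightarrow> (nat + nat) set" where
  "ends (i, j) = {Inl i, Inr j}"

definition matching_complex :: "nat set \<Rightarrow> nat set \<Rightarrow> (nat \<times> nat) set set" where
  "matching_complex S T =
     {\<sigma>. \<sigma> \<subseteq> S \<times> T \<and> pairwise (\<lambda>e e'. ends e \<inter> ends e' = {}) \<sigma>}"

definition Gamma :: "nat \<Rightarrow> nat \<Rightarrow> (nat \<times> nat) set set" where
  "Gamma m n = {\<sigma> \<in> matching_complex {1..m} {1..n}. \<forall>s\<in>{3..m}. (s, 1) \<notin> \<sigma>}"

definition P_hat ::
  "('a, 'r) ring_scheme \<Rightarrow> nat \<Rightarrow> nat \<Rightarrow> int \<Rightarrow>
     ('a, nat \<Rightarrow> ((nat \<times> nat) set \<Rightarrow> 'a) set) module" where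
  "P_hat R m n d =
     direct_sum {3..m} (\<lambda>s. reduced_homology R (matching_complex ({1..m} - {s}) {2..n}) d)"

lemma simplicial_complex_matching_complex:
  assumes "finite S" and "finite T"
  shows "simplicial_complex (matching_complex S T)"
  unfolding simplicial_complex_def matching_complex_def
  using assms by (auto intro: finite_subset pairwise_mono)

lemma simplicial_complex_Gamma: "simplicial_complex (Gamma m n)"
  using simplicial_complex_matching_complex[of "{1..m}" "{1..n}"]
  unfolding simplicial_complex_def Gamma_def by blast

end

(*
  The sequence is the long exact homology sequence of the pair (M, Gamma), M the full matching
  complex. A face of M outside Gamma contains exactly one of the edges (s, 1) with s >= 3, and
  removing that edge leaves a face of the link of (s, 1), which is the matching complex on the
  remaining vertices. Contracting with the edges (s, 1) thus identifies the relative chains with the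
  direct sum of the chains of the links, shifted by one degree; since contraction with a vertex
  anticommutes with the boundary operator, this passes to homology.
*)

theory Submission
  imports Defs
begin

text \<open>No relative chain complex is formed. The chain groups of the matching complex, of
  \<open>Gamma\<close> and of the links are all subgroups of the one group
  \<open>finite_chains\<close>, on which the boundary is a single endomorphism; inclusions of
  complexes are then inclusions of sets. Relative homology enters only through a map
  \<open>q\<close> out of the relative cycles that is linear and surjective and has the right
  kernel. All three maps of the sequence arise by factoring through such surjections, so neither a
  snake lemma nor a quotient of quotients occurs. The sign in the anticommutation is harmless,
  because cycles and boundaries are closed under negation. The coefficient ring may be
  noncommutative: signs are expressed by additive inverses, which are compatible with left
  multiplication by any scalar. The vertex type may be infinite, so boundary computations take place
  in a finite vertex set chosen for each chain.\<close>

section \<open>The homology sequence of a pair\<close>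

text \<open>
  Commutative groups on which the elements of \<open>R\<close> act by endomorphisms: associativity and unitality
  of the action play no role for exactness.
\<close>

locale operator_group = abelian_group M
  for R :: "('a, 'r) ring_scheme" and M :: "('a, 'b, 'm) module_scheme" (structure) +
  assumes smult_closed: "\<lbrakk>r \<in> carrier R; x \<in> carrier M\<rbrakk> \<Longrightarrow> r \<odot> x \<in> carrier M"
    and smult_r_distr:
      "\<lbrakk>r \<in> carrier R; x \<in> carrier M; y \<in> carrier M\<rbrakk> \<Longrightarrow> r \<odot> (x \<oplus> y) = r \<odot> x \<oplus> r \<odot> y"

section \<open>Linear maps and submodules\<close>

lemma linear_mapsI:
  assumes "\<And>x. x \<in> carrier M \<Longrightarrow> f x \<in> carrier N"
    and "\<And>x y. \<lbrakk>x \<in> carrier M; y \<in> carrier M\<rbrakk> \<Longrightarrow> f (x \<oplus>\<^bsub>M\<^esub> y) = f x \<oplus>\<^bsub>N\<^esub> f y"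
    and "\<And>r x. \<lbrakk>r \<in> carrier R; x \<in> carrier M\<rbrakk> \<Longrightarrow> f (r \<odot>\<^bsub>M\<^esub> x) = r \<odot>\<^bsub>N\<^esub> f x"
  shows "f \<in> linear_maps R M N"
  using assms by (auto simp: linear_maps_def hom_def)

lemma linear_mapsD:
  assumes "f \<in> linear_maps R M N"
  shows "x \<in> carrier M \<Longrightarrow> f x \<in> carrier N"
    and "\<lbrakk>x \<in> carrier M; y \<in> carrier M\<rbrakk> \<Longrightarrow> f (x \<oplus>\<^bsub>M\<^esub> y) = f x \<oplus>\<^bsub>N\<^esub> f y"
    and "\<lbrakk>r \<in> carrier R; x \<in> carrier M\<rbrakk> \<Longrightarrow> f (r \<odot>\<^bsub>M\<^esub> x) = r \<odot>\<^bsub>N\<^esub> f x"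
  using assms by (auto simp: linear_maps_def hom_def)

lemma linear_maps_compose:
  assumes "f \<in> linear_maps R M N" and "g \<in> linear_maps R N P"
  shows "(\<lambda>x. g (f x)) \<in> linear_maps R M P"
  by (rule linear_mapsI) (auto simp: linear_mapsD[OF assms(1)] linear_mapsD[OF assms(2)])

lemma linear_maps_restrict:
  assumes "f \<in> linear_maps R M N" and "H \<subseteq> carrier M" and "\<And>x. x \<in> H \<Longrightarrow> f x \<in> K"
  shows "f \<in> linear_maps R (M\<lparr>carrier := H\<rparr>) (N\<lparr>carrier := K\<rparr>)"
  by (rule linear_mapsI) (use assms(2,3) in \<open>auto simp: linear_mapsD[OF assms(1)] subset_iff\<close>)

text \<open>The condition is \<open>f a = f \<zero>\<close> rather than \<open>f a = \<zero>\<close>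
  in \<open>N\<close> because the target is not assumed to be a group. Later targets are homology
  groups and the terms \<open>P d\<close>, of which only images and kernels are known.\<close>

lemma (in operator_group) linear_maps_shift:
  assumes "f \<in> linear_maps R M N" and "x \<in> carrier M" and "a \<in> carrier M" and "f a = f \<zero>"
  shows "f (x \<oplus> a) = f x"
  using linear_mapsD(2)[OF assms(1) assms(2,3)] linear_mapsD(2)[OF assms(1,2) zero_closed] assms
  by simp

lemma (in operator_group) linear_maps_zero:
  assumes "operator_group R N" and "f \<in> linear_maps R M N"
  shows "f \<zero> = \<zero>\<^bsub>N\<^esub>"
proof -
  interpret N: operator_group R N by fact
  show ?thesis
    using linear_mapsD(1)[OF assms(2) zero_closed] linear_mapsD(2)[OF assms(2) zero_closed zero_closed]
    by (metis N.add.l_cancel_one' l_zero zero_closed)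
qed

lemma (in operator_group) linear_maps_minus:
  assumes "operator_group R N" and "f \<in> linear_maps R M N" and "x \<in> carrier M"
  shows "f (\<ominus> x) = \<ominus>\<^bsub>N\<^esub> f x"
proof -
  interpret N: operator_group R N by fact
  have "f (\<ominus> x) \<oplus>\<^bsub>N\<^esub> f x = \<zero>\<^bsub>N\<^esub>"
    using linear_mapsD(2)[OF assms(2), of "\<ominus> x" x] assms(3) linear_maps_zero[OF assms(1,2)]
    by (simp add: l_neg)
  then show ?thesis
    using assms(3) by (simp add: N.minus_equality linear_mapsD(1)[OF assms(2)])
qed

lemma (in operator_group) smult_zero: "r \<in> carrier R \<Longrightarrow> r \<odot> \<zero> = \<zero>"
  by (metis add.l_cancel_one' l_zero smult_closed smult_r_distr zero_closed)

lemma (in operator_group) submoduleI: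
  assumes "N \<subseteq> carrier M" and "\<zero> \<in> N" and "\<And>x. x \<in> N \<Longrightarrow> \<ominus> x \<in> N"
    and "\<And>x y. \<lbrakk>x \<in> N; y \<in> N\<rbrakk> \<Longrightarrow> x \<oplus> y \<in> N"
    and "\<And>r x. \<lbrakk>r \<in> carrier R; x \<in> N\<rbrakk> \<Longrightarrow> r \<odot> x \<in> N"
  shows "submodule N R M"
  using assms by (intro submodule.intro subgroup.intro) (auto simp: submodule_axioms_def a_inv_def)

lemma submoduleD:
  assumes "submodule N R M"
  shows "x \<in> N \<Longrightarrow> x \<in> carrier M" and "\<zero>\<^bsub>M\<^esub> \<in> N" and "x \<in> N \<Longrightarrow> \<ominus>\<^bsub>M\<^esub> x \<in> N"
    and "\<lbrakk>x \<in> N; y \<in> N\<rbrakk> \<Longrightarrow> x \<oplus>\<^bsub>M\<^esub> y \<in> N" and "\<lbrakk>r \<in> carrier R; x \<in> N\<rbrakk> \<Longrightarrow> r \<odot>\<^bsub>M\<^esub> x \<in> N"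
proof -
  interpret submodule N R M by fact
  interpret additive_subgroup N M using subgroup_axioms by (rule additive_subgroupI)
  show "x \<in> N \<Longrightarrow> x \<in> carrier M" "\<zero>\<^bsub>M\<^esub> \<in> N" "x \<in> N \<Longrightarrow> \<ominus>\<^bsub>M\<^esub> x \<in> N"
    "\<lbrakk>x \<in> N; y \<in> N\<rbrakk> \<Longrightarrow> x \<oplus>\<^bsub>M\<^esub> y \<in> N" "\<lbrakk>r \<in> carrier R; x \<in> N\<rbrakk> \<Longrightarrow> r \<odot>\<^bsub>M\<^esub> x \<in> N"
    using a_subset by auto
qed

lemma (in operator_group) submodule_operator_group:
  assumes "submodule N R M"
  shows "operator_group R (M\<lparr>carrier := N\<rparr>)"
proof (intro operator_group.intro abelian_groupI operator_group_axioms.intro)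
  note N = submoduleD[OF assms]
  fix x assume "x \<in> carrier (M\<lparr>carrier := N\<rparr>)"
  then show "\<exists>y\<in>carrier (M\<lparr>carrier := N\<rparr>). y \<oplus>\<^bsub>M\<lparr>carrier := N\<rparr>\<^esub> x = \<zero>\<^bsub>M\<lparr>carrier := N\<rparr>\<^esub>"
    using N(1,3) by (auto intro!: bexI[of _ "\<ominus> x"] simp: l_neg)
qed (use submoduleD[OF assms] in \<open>auto simp: a_assoc a_comm a_lcomm smult_r_distr\<close>)

lemma submodule_restrict:
  assumes "operator_group R M" and "submodule N R M" and "submodule H R M" and "N \<subseteq> H"
  shows "submodule N R (M\<lparr>carrier := H\<rparr>)"
proof -
  interpret M: operator_group R M by fact
  interpret H: operator_group R "M\<lparr>carrier := H\<rparr>"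
    by (rule M.submodule_operator_group) fact
  \<comment> \<open>An additive inverse is defined by a search in the carrier of the record, so
    inverses in the restricted record have to be compared with those in \<open>M\<close>.\<close>
  have "\<ominus>\<^bsub>M\<lparr>carrier := H\<rparr>\<^esub> x = \<ominus>\<^bsub>M\<^esub> x" if "x \<in> N" for x
    using that assms(4) submoduleD[OF assms(3)] submoduleD(1)[OF assms(2)]
    by (intro H.minus_equality) (auto simp: M.l_neg subset_iff)
  then show ?thesis
    using assms(4) submoduleD[OF assms(2)] by (intro H.submoduleI) auto
qed

lemma submodule_image:
  assumes "operator_group R M" and "operator_group R N" and f: "f \<in> linear_maps R M N"
    and "submodule H R M"
  shows "submodule (f ` H) R N"
proof -
  interpret M: operator_group R M by fact
  interpret N: operator_group R N by fact
  note H = submoduleD[OF assms(4)] and f = linear_mapsD[OF f]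
  show ?thesis
  proof (rule N.submoduleI)
    show "\<zero>\<^bsub>N\<^esub> \<in> f ` H"
      using H(2) M.linear_maps_zero[OF assms(2,3)] by (rule_tac image_eqI) auto
    fix x assume "x \<in> f ` H"
    then obtain a where a: "a \<in> H" "x = f a" by blast
    show "\<ominus>\<^bsub>N\<^esub> x \<in> f ` H"
      using a H M.linear_maps_minus[OF assms(2,3)] by (rule_tac image_eqI[of _ _ "\<ominus>\<^bsub>M\<^esub> a"]) auto
    show "r \<odot>\<^bsub>N\<^esub> x \<in> f ` H" if "r \<in> carrier R" for r
      using a that H f(3) by (rule_tac image_eqI[of _ _ "r \<odot>\<^bsub>M\<^esub> a"]) auto
    fix y assume "y \<in> f ` H"
    then obtain b where "b \<in> H" "y = f b" by blast
    then show "x \<oplus>\<^bsub>N\<^esub> y \<in> f ` H"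
      using a H f(2) by (rule_tac image_eqI[of _ _ "a \<oplus>\<^bsub>M\<^esub> b"]) auto
  qed (use H f in auto)
qed

lemma submodule_preimage:
  assumes "operator_group R M" and "operator_group R N" and f: "f \<in> linear_maps R M N"
    and "submodule H R M" and "submodule K R N"
  shows "submodule {x \<in> H. f x \<in> K} R M"
proof -
  interpret M: operator_group R M by fact
  interpret N: operator_group R N by fact
  show ?thesis
    using submoduleD[OF assms(4)] submoduleD[OF assms(5)] linear_mapsD[OF f]
    by (intro M.submoduleI)
      (auto simp: M.linear_maps_zero[OF assms(2,3)] M.linear_maps_minus[OF assms(2,3)])
qed

section \<open>Quotients and factorization through surjections\<close>

lemma
  assumes "operator_group R M" and "submodule N R M"
  shows coset_linear: "(\<lambda>x. N +>\<^bsub>M\<^esub> x) \<in> linear_maps R M (quotient_module M N)"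
    and coset_image: "(\<lambda>x. N +>\<^bsub>M\<^esub> x) ` carrier M = carrier (quotient_module M N)"
    and coset_eq_zero_iff:
      "x \<in> carrier M \<Longrightarrow> N +>\<^bsub>M\<^esub> x = \<zero>\<^bsub>quotient_module M N\<^esub> \<longleftrightarrow> x \<in> N"
proof -
  interpret M: operator_group R M by fact
  interpret N: submodule N R M by fact
  have add_sub: "additive_subgroup N M" using N.subgroup_axioms by (rule additive_subgroupI)
  interpret abelian_subgroup N M
    by (rule abelian_subgroupI3[OF add_sub M.abelian_group_axioms])
  show image: "(\<lambda>x. N +>\<^bsub>M\<^esub> x) ` carrier M = carrier (quotient_module M N)"
    by (auto simp: quotient_module_def A_RCOSETS_def')
  show "(\<lambda>x. N +>\<^bsub>M\<^esub> x) \<in> linear_maps R M (quotient_module M N)"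
  proof (rule linear_mapsI)
    fix r x assume rx: "r \<in> carrier R" "x \<in> carrier M"
    \<comment> \<open>The scalar action on a coset is a union over all its representatives. Each of
      them contributes the same coset, so the union collapses.\<close>
    have "N +>\<^bsub>M\<^esub> (r \<odot>\<^bsub>M\<^esub> y) = N +>\<^bsub>M\<^esub> (r \<odot>\<^bsub>M\<^esub> x)" if "y \<in> N +>\<^bsub>M\<^esub> x" for y
    proof -
      from that obtain n where n: "n \<in> N" "y = n \<oplus>\<^bsub>M\<^esub> x"
        by (auto simp: a_r_coset_def')
      have "r \<odot>\<^bsub>M\<^esub> y = r \<odot>\<^bsub>M\<^esub> n \<oplus>\<^bsub>M\<^esub> r \<odot>\<^bsub>M\<^esub> x"
        using n rx a_subset by (auto simp: M.smult_r_distr)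
      then have "r \<odot>\<^bsub>M\<^esub> y \<in> N +>\<^bsub>M\<^esub> (r \<odot>\<^bsub>M\<^esub> x)"
        using n rx by (auto simp: a_r_coset_def')
      then show ?thesis
        using M.a_repr_independence[OF _ _ a_subgroup] rx M.smult_closed by metis
    qed
    moreover have "x \<in> N +>\<^bsub>M\<^esub> x" using rx by (rule_tac a_rcos_self)
    ultimately have "(\<Union>y\<in>N +>\<^bsub>M\<^esub> x. N +>\<^bsub>M\<^esub> (r \<odot>\<^bsub>M\<^esub> y)) = N +>\<^bsub>M\<^esub> (r \<odot>\<^bsub>M\<^esub> x)"
      by blast
    then show "N +>\<^bsub>M\<^esub> (r \<odot>\<^bsub>M\<^esub> x) = r \<odot>\<^bsub>quotient_module M N\<^esub> (N +>\<^bsub>M\<^esub> x)"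
      unfolding quotient_module_def by simp
  qed (use image in \<open>auto simp: quotient_module_def a_rcos_sum\<close>)
  show "N +>\<^bsub>M\<^esub> x = \<zero>\<^bsub>quotient_module M N\<^esub> \<longleftrightarrow> x \<in> N" if "x \<in> carrier M"
    using that M.a_coset_join1[OF _ _ a_subgroup] M.a_coset_join2[OF _ a_subgroup]
    by (auto simp: quotient_module_def)
qed

text \<open>Two preimages of the same element differ by an element that \<open>u\<close>, and hence
  \<open>w\<close>, treats like zero; therefore \<open>w\<close> can be evaluated on an arbitrary
  preimage. Every map of the long exact sequence is produced in this way.\<close>

lemma (in operator_group) linear_map_factor:
  assumes u: "u \<in> linear_maps R M N" and w: "w \<in> linear_maps R M P"
    and surj: "u ` carrier M = carrier N"
    and ker: "\<And>x. \<lbrakk>x \<in> carrier M; u x = u \<zero>\<rbrakk> \<Longrightarrow> w x = w \<zero>"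
  shows "\<exists>f\<in>linear_maps R N P. \<forall>x\<in>carrier M. f (u x) = w x"
proof -
  have eq: "w x = w y" if "x \<in> carrier M" "y \<in> carrier M" "u x = u y" for x y
  proof -
    have "u (x \<ominus> y) = u x \<oplus>\<^bsub>N\<^esub> u (\<ominus> y)"
      unfolding minus_eq using that by (intro linear_mapsD(2)[OF u]) auto
    also have "\<dots> = u (y \<oplus> \<ominus> y)"
      unfolding that(3) using that by (intro linear_mapsD(2)[OF u, symmetric]) auto
    finally have "u (x \<ominus> y) = u \<zero>" using that by (simp only: r_neg)
    then have "w (x \<ominus> y) = w \<zero>" using that by (intro ker) auto
    then have "w (y \<oplus> (x \<ominus> y)) = w y" using that by (intro linear_maps_shift[OF w]) auto
    moreover have "y \<oplus> (x \<ominus> y) = x"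
      using that by (simp add: minus_eq a_lcomm[of y x] r_neg)
    ultimately show ?thesis by simp
  qed
  define f where "f = (\<lambda>y. w (inv_into (carrier M) u y))"
  have f: "f (u x) = w x" if "x \<in> carrier M" for x
    unfolding f_def using that by (intro eq) (simp_all add: inv_into_into f_inv_into_f)
  have "f \<in> linear_maps R N P"
  proof (rule linear_mapsI)
    fix y assume "y \<in> carrier N"
    then obtain x where x: "x \<in> carrier M" "y = u x" using surj by blast
    then show "f y \<in> carrier P" using linear_mapsD(1)[OF w] by (simp add: f)
    show "f (r \<odot>\<^bsub>N\<^esub> y) = r \<odot>\<^bsub>P\<^esub> f y" if "r \<in> carrier R" for r
      unfolding x(2) f[OF x(1)] linear_mapsD(3)[OF u that x(1), symmetric]
        f[OF smult_closed[OF that x(1)]]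
      by (rule linear_mapsD(3)[OF w that x(1)])
    fix z assume "z \<in> carrier N"
    then obtain x' where x': "x' \<in> carrier M" "z = u x'" using surj by blast
    show "f (y \<oplus>\<^bsub>N\<^esub> z) = f y \<oplus>\<^bsub>P\<^esub> f z"
      unfolding x(2) x'(2) f[OF x(1)] f[OF x'(1)] linear_mapsD(2)[OF u x(1) x'(1), symmetric]
        f[OF a_closed[OF x(1) x'(1)]]
      by (rule linear_mapsD(2)[OF w x(1) x'(1)])
  qed
  then show ?thesis using f by blast
qed

section \<open>Homology of graded families of subgroups\<close>

definition homology_class ::
  "('a, 'b, 'm) module_scheme \<Rightarrow> ('b \<Rightarrow> 'b) \<Rightarrow> (int \<Rightarrow> 'b set) \<Rightarrow> int \<Rightarrow> 'b \<Rightarrow> 'b set" where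
  "homology_class E \<delta> K d x = \<delta> ` K (d + 1) +>\<^bsub>E\<lparr>carrier := {x \<in> K d. \<delta> x = \<zero>\<^bsub>E\<^esub>}\<rparr>\<^esub> x"

text \<open>A complex is a family \<open>K\<close> of subgroups of one ambient group with one
  operator. For \<open>C d \<subseteq> D d\<close> the induced map on homology then sends the class
  of \<open>x\<close> to the class of the same \<open>x\<close>.\<close>

definition homology ::
  "('a, 'b, 'm) module_scheme \<Rightarrow> ('b \<Rightarrow> 'b) \<Rightarrow> (int \<Rightarrow> 'b set) \<Rightarrow> int \<Rightarrow> ('a, 'b set) module" where
  "homology E \<delta> K d =
     quotient_module (E\<lparr>carrier := {x \<in> K d. \<delta> x = \<zero>\<^bsub>E\<^esub>}\<rparr>) (\<delta> ` K (d + 1))"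

lemma cycles_submodule:
  assumes "operator_group R E" and \<delta>: "\<delta> \<in> linear_maps R E E" and K: "submodule K R E"
  shows "submodule {x \<in> K. \<delta> x = \<zero>\<^bsub>E\<^esub>} R E"
proof -
  interpret E: operator_group R E by fact
  have "submodule {\<zero>\<^bsub>E\<^esub>} R E"
    by (rule E.submoduleI) (auto simp: E.smult_zero)
  from submodule_preimage[OF assms(1,1) \<delta> K this] show ?thesis by simp
qed

text \<open>From here on homology is accessed only through these three facts. They have the same
  shape as the assumptions on \<open>q\<close> in the theorem below, so homology groups and the
  terms \<open>P d\<close> can be treated alike.\<close>

lemma
  assumes "operator_group R E" and \<delta>: "\<delta> \<in> linear_maps R E E"
    and \<delta>\<delta>: "\<And>x. x \<in> carrier E \<Longrightarrow> \<delta> (\<delta> x) = \<zero>\<^bsub>E\<^esub>"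
    and K: "\<forall>d. submodule (K d) R E" and \<delta>K: "\<forall>d. \<forall>x\<in>K d. \<delta> x \<in> K (d - 1)"
  shows homology_class_linear: "homology_class E \<delta> K d \<in>
      linear_maps R (E\<lparr>carrier := {x \<in> K d. \<delta> x = \<zero>\<^bsub>E\<^esub>}\<rparr>) (homology E \<delta> K d)"
    and homology_class_image:
      "homology_class E \<delta> K d ` {x \<in> K d. \<delta> x = \<zero>\<^bsub>E\<^esub>} = carrier (homology E \<delta> K d)"
    and homology_class_eq_zero_iff: "\<lbrakk>x \<in> K d; \<delta> x = \<zero>\<^bsub>E\<^esub>\<rbrakk> \<Longrightarrow>
      homology_class E \<delta> K d x = \<zero>\<^bsub>homology E \<delta> K d\<^esub> \<longleftrightarrow> x \<in> \<delta> ` K (d + 1)"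
proof -
  interpret E: operator_group R E by fact
  let ?Z = "{x \<in> K d. \<delta> x = \<zero>\<^bsub>E\<^esub>}"
  have Z: "submodule ?Z R E" by (rule cycles_submodule[OF assms(1,2) K[rule_format]])
  have group: "operator_group R (E\<lparr>carrier := ?Z\<rparr>)"
    by (rule E.submodule_operator_group[OF Z])
  have "submodule (\<delta> ` K (d + 1)) R (E\<lparr>carrier := ?Z\<rparr>)"
  proof (rule submodule_restrict[OF assms(1) _ Z])
    show "submodule (\<delta> ` K (d + 1)) R E"
      by (rule submodule_image[OF assms(1,1) \<delta> K[rule_format]])
    show "\<delta> ` K (d + 1) \<subseteq> ?Z"
      using \<delta>K[THEN spec, of "d + 1"] submoduleD(1)[OF K[rule_format]] by (auto simp: \<delta>\<delta>)
  qed
  note * = group this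
  show "homology_class E \<delta> K d \<in> linear_maps R (E\<lparr>carrier := ?Z\<rparr>) (homology E \<delta> K d)"
    "homology_class E \<delta> K d ` ?Z = carrier (homology E \<delta> K d)"
    using coset_linear[OF *] coset_image[OF *]
    by (simp_all add: homology_class_def[abs_def] homology_def)
  show "homology_class E \<delta> K d x = \<zero>\<^bsub>homology E \<delta> K d\<^esub> \<longleftrightarrow> x \<in> \<delta> ` K (d + 1)"
    if "x \<in> K d" "\<delta> x = \<zero>\<^bsub>E\<^esub>"
    using coset_eq_zero_iff[OF *, of x] that by (simp add: homology_class_def homology_def)
qed

text \<open>
  The family \<open>q\<close> presents \<open>P d\<close> as the relative homology of \<open>(D, C)\<close> in degree \<open>d + 1\<close>: relative cycles
  modulo boundaries and chains of \<open>C\<close>.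
\<close>

theorem long_exact_sequence_of_pair:
  fixes E :: "('a, 'b, 'm) module_scheme" and C D :: "int \<Rightarrow> 'b set"
    and P :: "int \<Rightarrow> ('a, 'c, 'n) module_scheme"
  assumes "operator_group R E" and \<delta>: "\<delta> \<in> linear_maps R E E"
    and \<delta>\<delta>: "\<And>x. x \<in> carrier E \<Longrightarrow> \<delta> (\<delta> x) = \<zero>\<^bsub>E\<^esub>"
    and C: "\<And>d. submodule (C d) R E" and \<delta>C: "\<And>d x. x \<in> C d \<Longrightarrow> \<delta> x \<in> C (d - 1)"
    and D: "\<And>d. submodule (D d) R E" and \<delta>D: "\<And>d x. x \<in> D d \<Longrightarrow> \<delta> x \<in> D (d - 1)"
    and CD: "\<And>d. C d \<subseteq> D d"
    and q: "\<And>d. q d \<in> linear_maps R (E\<lparr>carrier := {x \<in> D (d + 1). \<delta> x \<in> C d}\<rparr>) (P d)"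
    and q_surj: "\<And>d. q d ` {x \<in> D (d + 1). \<delta> x \<in> C d} = carrier (P d)"
    and q_ker: "\<And>d x. \<lbrakk>x \<in> D (d + 1); \<delta> x \<in> C d\<rbrakk> \<Longrightarrow>
      q d x = \<zero>\<^bsub>P d\<^esub> \<longleftrightarrow> (\<exists>y\<in>D (d + 2). \<exists>a\<in>C (d + 1). x = \<delta> y \<oplus>\<^bsub>E\<^esub> a)"
  shows "\<exists>f g h. long_exact_sequence R P (homology E \<delta> C) (homology E \<delta> D) f g h"
proof -
  interpret E: operator_group R E by fact
  define Z where "Z K d = {x \<in> K d. \<delta> x = \<zero>\<^bsub>E\<^esub>}" for K :: "int \<Rightarrow> 'b set" and d
  \<comment> \<open>The relative cycles of degree \<open>d + 1\<close>, indexed by the degree of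
    their boundaries to agree with the index of \<open>P d\<close>.\<close>
  define X where "X d = {x \<in> D (d + 1). \<delta> x \<in> C d}" for d
  define H where "H = homology E \<delta>"
  define p where "p = homology_class E \<delta>"
  note \<delta>_zero = E.linear_maps_zero[OF assms(1) \<delta>]
  note C' = submoduleD[OF C] and D' = submoduleD[OF D]
  have Z_submodule: "submodule (Z K d) R E" if "\<And>d. submodule (K d) R E" for K d
    using cycles_submodule[OF assms(1,2) that] by (simp add: Z_def)
  have X_submodule: "submodule (X d) R E" for d
    using submodule_preimage[OF assms(1,1) \<delta> D C] by (simp add: X_def)
  have Z_group: "operator_group R (E\<lparr>carrier := Z K d\<rparr>)" if "\<And>d. submodule (K d) R E" for K d
    by (rule E.submodule_operator_group[OF Z_submodule[OF that]])
  have X_group: "operator_group R (E\<lparr>carrier := X d\<rparr>)" for d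
    by (rule E.submodule_operator_group[OF X_submodule])
  have p: "p K d \<in> linear_maps R (E\<lparr>carrier := Z K d\<rparr>) (H K d)" "p K d ` Z K d = carrier (H K d)"
    "\<And>x. x \<in> Z K d \<Longrightarrow> p K d x = \<zero>\<^bsub>H K d\<^esub> \<longleftrightarrow> x \<in> \<delta> ` K (d + 1)"
    if "\<forall>d. submodule (K d) R E" "\<forall>d. \<forall>x\<in>K d. \<delta> x \<in> K (d - 1)" for K d
    using homology_class_linear[OF assms(1-3) that] homology_class_image[OF assms(1-3) that]
      homology_class_eq_zero_iff[OF assms(1-3) that]
    by (auto simp: p_def H_def Z_def)
  have "\<forall>d. \<forall>x\<in>C d. \<delta> x \<in> C (d - 1)" "\<forall>d. \<forall>x\<in>D d. \<delta> x \<in> D (d - 1)"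
    "\<forall>d. submodule (C d) R E" "\<forall>d. submodule (D d) R E"
    using C D \<delta>C \<delta>D by auto
  note pC = p[OF this(3,1)] and pD = p[OF this(4,2)]
  have p_zero: "p C d \<zero>\<^bsub>E\<^esub> = \<zero>\<^bsub>H C d\<^esub>" "p D d \<zero>\<^bsub>E\<^esub> = \<zero>\<^bsub>H D d\<^esub>" for d
    using pC(3)[of "\<zero>\<^bsub>E\<^esub>" d] pD(3)[of "\<zero>\<^bsub>E\<^esub>" d] C'(2) D'(2) \<delta>_zero
    by (auto simp: Z_def image_iff intro!: bexI[of _ "\<zero>\<^bsub>E\<^esub>"])
  \<comment> \<open>With no group axioms for \<open>P d\<close>, the value at zero is read off from
    \<open>q_ker\<close>, applied to the decomposition of zero as a boundary plus a chain of
    \<open>C\<close>.\<close>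
  have q_zero: "q d \<zero>\<^bsub>E\<^esub> = \<zero>\<^bsub>P d\<^esub>" for d
  proof -
    have "\<zero>\<^bsub>E\<^esub> = \<delta> \<zero>\<^bsub>E\<^esub> \<oplus>\<^bsub>E\<^esub> \<zero>\<^bsub>E\<^esub>" by (simp add: \<delta>_zero)
    then show ?thesis
      using q_ker[of "\<zero>\<^bsub>E\<^esub>" d] C'(2)[of d] C'(2)[of "d + 1"] D'(2)[of "d + 1"] D'(2)[of "d + 2"]
      by (metis \<delta>_zero)
  qed
  have ZC_ZD: "x \<in> Z D d" if "x \<in> Z C d" for x d
    using that CD by (auto simp: Z_def)
  have ZD_X: "x \<in> X (d - 1)" if "x \<in> Z D d" for x d
    using that C'(2) by (auto simp: Z_def X_def)
  have \<delta>_X: "\<delta> x \<in> Z C d" if "x \<in> X d" for x d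
    using that D'(1) by (auto simp: Z_def X_def \<delta>\<delta>)
  \<comment> \<open>The connecting map: a relative cycle goes to the class of its boundary in
    \<open>C\<close>. If \<open>q\<close> kills \<open>x\<close>, then \<open>x\<close> is a
    boundary plus some \<open>a\<close> in \<open>C\<close>, so its boundary is that of
    \<open>a\<close> and vanishes in the homology of \<open>C\<close>.\<close>
  have "\<exists>f\<in>linear_maps R (P d) (H C d). \<forall>x\<in>X d. f (q d x) = p C d (\<delta> x)" for d
  proof -
    interpret X: operator_group R "E\<lparr>carrier := X d\<rparr>" by (rule X_group)
    have "\<exists>f\<in>linear_maps R (P d) (H C d). \<forall>x\<in>carrier (E\<lparr>carrier := X d\<rparr>). f (q d x) = p C d (\<delta> x)"
    proof (rule X.linear_map_factor)
      show "q d \<in> linear_maps R (E\<lparr>carrier := X d\<rparr>) (P d)"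
        using q by (simp add: X_def)
      show "(\<lambda>x. p C d (\<delta> x)) \<in> linear_maps R (E\<lparr>carrier := X d\<rparr>) (H C d)"
        by (rule linear_maps_compose[OF linear_maps_restrict[OF \<delta>] pC(1)])
          (use submoduleD(1)[OF X_submodule] \<delta>_X in auto)
      show "q d ` carrier (E\<lparr>carrier := X d\<rparr>) = carrier (P d)"
        using q_surj by (simp add: X_def)
      fix x assume "x \<in> carrier (E\<lparr>carrier := X d\<rparr>)" "q d x = q d \<zero>\<^bsub>E\<lparr>carrier := X d\<rparr>\<^esub>"
      then have x: "x \<in> X d" "q d x = \<zero>\<^bsub>P d\<^esub>" by (simp_all add: q_zero)
      then obtain y a where ya: "y \<in> D (d + 2)" "a \<in> C (d + 1)" "x = \<delta> y \<oplus>\<^bsub>E\<^esub> a"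
        using q_ker[of x d] by (auto simp: X_def)
      then have "\<delta> x = \<delta> a"
        using C'(1) D'(1) linear_mapsD(1,2)[OF \<delta>] by (simp add: \<delta>\<delta>)
      then have "\<delta> x \<in> \<delta> ` C (d + 1)" using ya by simp
      then show "p C d (\<delta> x) = p C d (\<delta> \<zero>\<^bsub>E\<lparr>carrier := X d\<rparr>\<^esub>)"
        using pC(3)[OF \<delta>_X[OF x(1)]] by (simp add: \<delta>_zero p_zero)
    qed
    then show ?thesis by simp
  qed
  then obtain f where f: "\<And>d. f d \<in> linear_maps R (P d) (H C d)"
    "\<And>d x. x \<in> X d \<Longrightarrow> f d (q d x) = p C d (\<delta> x)"
    by metis
  have "\<exists>g\<in>linear_maps R (H C d) (H D d). \<forall>x\<in>Z C d. g (p C d x) = p D d x" for d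
  proof -
    interpret Z: operator_group R "E\<lparr>carrier := Z C d\<rparr>" by (rule Z_group[OF C])
    have "\<exists>g\<in>linear_maps R (H C d) (H D d). \<forall>x\<in>carrier (E\<lparr>carrier := Z C d\<rparr>). g (p C d x) = p D d x"
    proof (rule Z.linear_map_factor)
      show "p D d \<in> linear_maps R (E\<lparr>carrier := Z C d\<rparr>) (H D d)"
        by (rule linear_mapsI) (use linear_mapsD[OF pD(1)[of d]] ZC_ZD in auto)
      fix x assume "x \<in> carrier (E\<lparr>carrier := Z C d\<rparr>)" "p C d x = p C d \<zero>\<^bsub>E\<lparr>carrier := Z C d\<rparr>\<^esub>"
      then have x: "x \<in> Z C d" "p C d x = \<zero>\<^bsub>H C d\<^esub>" by (simp_all add: p_zero)
      then have "x \<in> \<delta> ` D (d + 1)" using pC(3)[of x d] CD[of "d + 1"] by auto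
      then show "p D d x = p D d \<zero>\<^bsub>E\<lparr>carrier := Z C d\<rparr>\<^esub>"
        using pD(3)[OF ZC_ZD[OF x(1)]] by (simp add: p_zero)
    qed (use pC in auto)
    then show ?thesis by simp
  qed
  then obtain g where g: "\<And>d. g d \<in> linear_maps R (H C d) (H D d)"
    "\<And>d x. x \<in> Z C d \<Longrightarrow> g d (p C d x) = p D d x"
    by metis
  \<comment> \<open>This is \<open>q_ker\<close> with the degree lowered by one, its indices
    normalized for use with cycles of degree \<open>d\<close>.\<close>
  have q_zero_iff: "q (d - 1) x = \<zero>\<^bsub>P (d - 1)\<^esub> \<longleftrightarrow> (\<exists>y\<in>D (d + 1). \<exists>a\<in>C d. x = \<delta> y \<oplus>\<^bsub>E\<^esub> a)"
    if "x \<in> X (d - 1)" for d x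
    using q_ker[of x "d - 1"] that by (simp add: X_def algebra_simps)
  \<comment> \<open>An absolute cycle is read as a relative one. Boundaries are killed by
    \<open>q_ker\<close>, with zero as the chain of \<open>C\<close>.\<close>
  have "\<exists>h\<in>linear_maps R (H D d) (P (d - 1)). \<forall>x\<in>Z D d. h (p D d x) = q (d - 1) x" for d
  proof -
    interpret Z: operator_group R "E\<lparr>carrier := Z D d\<rparr>" by (rule Z_group[OF D])
    have "\<exists>h\<in>linear_maps R (H D d) (P (d - 1)).
        \<forall>x\<in>carrier (E\<lparr>carrier := Z D d\<rparr>). h (p D d x) = q (d - 1) x"
    proof (rule Z.linear_map_factor)
      show "q (d - 1) \<in> linear_maps R (E\<lparr>carrier := Z D d\<rparr>) (P (d - 1))"
        by (rule linear_mapsI)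
          (use linear_mapsD[OF q[of "d - 1"], folded X_def] ZD_X in auto)
      fix x assume "x \<in> carrier (E\<lparr>carrier := Z D d\<rparr>)" "p D d x = p D d \<zero>\<^bsub>E\<lparr>carrier := Z D d\<rparr>\<^esub>"
      then have x: "x \<in> Z D d" "p D d x = \<zero>\<^bsub>H D d\<^esub>" by (simp_all add: p_zero)
      then obtain y where y: "y \<in> D (d + 1)" "x = \<delta> y" using pD(3)[of x d] by auto
      then have "x = \<delta> y \<oplus>\<^bsub>E\<^esub> \<zero>\<^bsub>E\<^esub>" using D'(1) linear_mapsD(1)[OF \<delta>] by simp
      then show "q (d - 1) x = q (d - 1) \<zero>\<^bsub>E\<lparr>carrier := Z D d\<rparr>\<^esub>"
        using q_zero_iff[OF ZD_X[OF x(1)]] y C'(2) by (auto simp: q_zero)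
    qed (use pD in auto)
    then show ?thesis by simp
  qed
  then obtain h where h: "\<And>d. h d \<in> linear_maps R (H D d) (P (d - 1))"
    "\<And>d x. x \<in> Z D d \<Longrightarrow> h d (p D d x) = q (d - 1) x"
    by metis
  have P_image: "carrier (P d) = q d ` X d" for d using q_surj by (simp add: X_def)
  have kernel: "a_kernel M N u = {x \<in> carrier M. u x = \<zero>\<^bsub>N\<^esub>}" 
    for M :: "('a, 'x, 'y) module_scheme" and N :: "('a, 'z, 'w) module_scheme" and u
    by (simp add: a_kernel_def kernel_def)
  have "f d ` carrier (P d) = a_kernel (H C d) (H D d) (g d)" for d
  proof -
    have "f d ` carrier (P d) = (\<lambda>x. p C d (\<delta> x)) ` X d"
      unfolding P_image image_image by (rule image_cong) (simp_all add: f)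
    moreover have "a_kernel (H C d) (H D d) (g d) = p C d ` {z \<in> Z C d. z \<in> \<delta> ` D (d + 1)}"
    proof -
      have "g d (p C d z) = \<zero>\<^bsub>H D d\<^esub> \<longleftrightarrow> z \<in> \<delta> ` D (d + 1)" if "z \<in> Z C d" for z
        using g(2)[OF that] pD(3)[OF ZC_ZD[OF that]] by simp
      then show ?thesis unfolding kernel pC(2)[symmetric] by blast
    qed
    \<comment> \<open>Exactness at the homology of \<open>C\<close>: a chain of \<open>D\<close>
      whose boundary is a cycle of \<open>C\<close> is, by definition, a relative cycle.\<close>
    moreover have "{z \<in> Z C d. z \<in> \<delta> ` D (d + 1)} = \<delta> ` X d"
      using D'(1) by (auto simp: X_def Z_def \<delta>\<delta>)
    ultimately show ?thesis by auto
  qed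
  moreover have "g d ` carrier (H C d) = a_kernel (H D d) (P (d - 1)) (h d)" for d
  proof -
    have "g d ` carrier (H C d) = p D d ` Z C d"
      unfolding pC(2)[symmetric] image_image by (rule image_cong) (simp_all add: g)
    moreover have "a_kernel (H D d) (P (d - 1)) (h d) =
        p D d ` {z \<in> Z D d. q (d - 1) z = \<zero>\<^bsub>P (d - 1)\<^esub>}"
      unfolding kernel pD(2)[symmetric] using h(2) by auto
    moreover have "p D d ` Z C d = p D d ` {z \<in> Z D d. q (d - 1) z = \<zero>\<^bsub>P (d - 1)\<^esub>}"
    proof (intro equalityI image_subsetI)
      fix z assume z: "z \<in> Z C d"
      then have "z = \<delta> \<zero>\<^bsub>E\<^esub> \<oplus>\<^bsub>E\<^esub> z" using C'(1)[of z d] by (simp add: Z_def \<delta>_zero)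
      then have "q (d - 1) z = \<zero>\<^bsub>P (d - 1)\<^esub>"
        using q_zero_iff[OF ZD_X[OF ZC_ZD[OF z]]] D'(2)[of "d + 1"] z unfolding Z_def by blast
      then show "p D d z \<in> p D d ` {z \<in> Z D d. q (d - 1) z = \<zero>\<^bsub>P (d - 1)\<^esub>}"
        using ZC_ZD[OF z] by simp
    next
      fix z assume "z \<in> {z \<in> Z D d. q (d - 1) z = \<zero>\<^bsub>P (d - 1)\<^esub>}"
      then have z: "z \<in> Z D d" "q (d - 1) z = \<zero>\<^bsub>P (d - 1)\<^esub>" by auto
      \<comment> \<open>Here \<open>a\<close> is a cycle of \<open>C\<close> that differs from
        \<open>z\<close> by a boundary of \<open>D\<close>, so both have the same class in the
        homology of \<open>D\<close>.\<close>
      then obtain y a where ya: "y \<in> D (d + 1)" "a \<in> C d" "z = \<delta> y \<oplus>\<^bsub>E\<^esub> a"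
        using q_zero_iff[OF ZD_X] by blast
      have carr: "y \<in> carrier E" "a \<in> carrier E" "\<delta> y \<in> carrier E" "\<delta> a \<in> carrier E"
        using ya C'(1) D'(1) linear_mapsD(1)[OF \<delta>] by auto
      have "\<delta> z = \<delta> a"
        unfolding ya(3) using carr linear_mapsD(2)[OF \<delta>, of "\<delta> y" a] by (simp add: \<delta>\<delta>)
      then have a: "a \<in> Z C d" using ya z by (auto simp: Z_def)
      have \<delta>y: "\<delta> y \<in> Z D d" using ya carr \<delta>D[of y "d + 1"] by (simp add: Z_def \<delta>\<delta>)
      interpret Z: operator_group R "E\<lparr>carrier := Z D d\<rparr>" by (rule Z_group[OF D])
      have "p D d (a \<oplus>\<^bsub>E\<^esub> \<delta> y) = p D d a"
        using Z.linear_maps_shift[OF pD(1), of a "\<delta> y"] ZC_ZD[OF a] \<delta>y pD(3)[OF \<delta>y] ya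
        by (simp add: p_zero)
      then have "p D d z = p D d a" using ya carr by (simp add: E.a_comm)
      then show "p D d z \<in> p D d ` Z C d" using a by simp
    qed
    ultimately show ?thesis by simp
  qed
  moreover have "h d ` carrier (H D d) = a_kernel (P (d - 1)) (H C (d - 1)) (f (d - 1))" for d
  proof -
    have "h d ` carrier (H D d) = q (d - 1) ` Z D d"
      unfolding pD(2)[symmetric] image_image by (rule image_cong) (simp_all add: h)
    moreover have "a_kernel (P (d - 1)) (H C (d - 1)) (f (d - 1)) =
        q (d - 1) ` {x \<in> X (d - 1). \<delta> x \<in> \<delta> ` C d}"
    proof -
      have "f (d - 1) (q (d - 1) x) = \<zero>\<^bsub>H C (d - 1)\<^esub> \<longleftrightarrow> \<delta> x \<in> \<delta> ` C d" if "x \<in> X (d - 1)" for x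
        using f(2)[OF that] pC(3)[OF \<delta>_X[OF that]] by simp
      then show ?thesis unfolding kernel P_image by blast
    qed
    moreover have "q (d - 1) ` Z D d = q (d - 1) ` {x \<in> X (d - 1). \<delta> x \<in> \<delta> ` C d}"
    proof (intro equalityI image_subsetI)
      fix z assume z: "z \<in> Z D d"
      then have "\<delta> z = \<delta> \<zero>\<^bsub>E\<^esub>" by (simp add: Z_def \<delta>_zero)
      then show "q (d - 1) z \<in> q (d - 1) ` {x \<in> X (d - 1). \<delta> x \<in> \<delta> ` C d}"
        using ZD_X[OF z] C'(2)[of d] by auto
    next
      fix x assume "x \<in> {x \<in> X (d - 1). \<delta> x \<in> \<delta> ` C d}"
      then obtain a where x: "x \<in> X (d - 1)" and a: "a \<in> C d" "\<delta> x = \<delta> a" by auto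
      \<comment> \<open>Subtracting \<open>a\<close> turns the relative cycle \<open>x\<close> into
        an absolute cycle. The value of \<open>q\<close> does not change, since \<open>q\<close>
        kills chains of \<open>C\<close>.\<close>
      define z where "z = x \<oplus>\<^bsub>E\<^esub> \<ominus>\<^bsub>E\<^esub> a"
      have xD: "x \<in> D d" using x by (simp add: X_def)
      have carr: "x \<in> carrier E" "a \<in> carrier E" "\<delta> a \<in> carrier E"
        using xD a C'(1) D'(1) linear_mapsD(1)[OF \<delta>] by auto
      have "\<delta> z = \<zero>\<^bsub>E\<^esub>"
        using carr a linear_mapsD(2)[OF \<delta>, of x "\<ominus>\<^bsub>E\<^esub> a"] E.linear_maps_minus[OF assms(1) \<delta>, of a]
        by (simp add: z_def E.r_neg)
      moreover have "z \<in> D d"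
        unfolding z_def by (intro D'(4) xD D'(3)) (use a CD in blast)
      ultimately have z: "z \<in> Z D d" by (simp add: Z_def)
      have aX: "a \<in> X (d - 1)" using a CD[of d] \<delta>C[of a d] by (auto simp: X_def)
      have "a = \<delta> \<zero>\<^bsub>E\<^esub> \<oplus>\<^bsub>E\<^esub> a" using carr by (simp add: \<delta>_zero)
      then have "q (d - 1) a = \<zero>\<^bsub>P (d - 1)\<^esub>"
        using q_zero_iff[OF aX] D'(2)[of "d + 1"] a(1) by blast
      moreover interpret X: operator_group R "E\<lparr>carrier := X (d - 1)\<rparr>" by (rule X_group)
      have "q (d - 1) \<in> linear_maps R (E\<lparr>carrier := X (d - 1)\<rparr>) (P (d - 1))"
        using q[of "d - 1"] by (simp add: X_def)
      ultimately have "q (d - 1) (z \<oplus>\<^bsub>E\<^esub> a) = q (d - 1) z"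
        using X.linear_maps_shift[of "q (d - 1)" "P (d - 1)" z a] ZD_X[OF z] aX
        by (simp add: q_zero)
      moreover have "z \<oplus>\<^bsub>E\<^esub> a = x" using carr by (simp add: z_def E.a_assoc E.l_neg)
      ultimately show "q (d - 1) x \<in> q (d - 1) ` Z D d" using z by auto
    qed
    ultimately show ?thesis by simp
  qed
  ultimately have "long_exact_sequence R P (H C) (H D) f g h"
    using f(1) g(1) h(1) by (simp add: long_exact_sequence_def)
  then show ?thesis unfolding H_def by blast
qed

section \<open>The boundary operator as a sum of contractions\<close>

lemma free_module_simps:
  "c \<in> carrier (free_module R X) \<longleftrightarrow>
     (\<forall>x\<in>X. c x \<in> carrier R) \<and> (\<forall>x. x \<notin> X \<longrightarrow> c x = \<zero>\<^bsub>R\<^esub>) \<and> finite {x. c x \<noteq> \<zero>\<^bsub>R\<^esub>}"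
  "\<zero>\<^bsub>free_module R X\<^esub> = (\<lambda>x. \<zero>\<^bsub>R\<^esub>)"
  "c \<oplus>\<^bsub>free_module R X\<^esub> d = (\<lambda>x. c x \<oplus>\<^bsub>R\<^esub> d x)"
  "r \<odot>\<^bsub>free_module R X\<^esub> c = (\<lambda>x. r \<otimes>\<^bsub>R\<^esub> c x)"
  by (simp_all add: free_module_def)

context ring
begin

lemma free_module_coeff: "c \<in> carrier (free_module R X) \<Longrightarrow> c x \<in> carrier R"
  by (cases "x \<in> X") (auto simp: free_module_simps)

lemma free_module_add_closed:
  assumes "c \<in> carrier (free_module R X)" and "d \<in> carrier (free_module R X)"
  shows "(\<lambda>x. c x \<oplus> d x) \<in> carrier (free_module R X)"
proof -
  have "finite {x. c x \<oplus> d x \<noteq> \<zero>}"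
    by (rule finite_subset[of _ "{x. c x \<noteq> \<zero>} \<union> {x. d x \<noteq> \<zero>}"])
      (use assms in \<open>auto simp: free_module_simps\<close>)
  then show ?thesis using assms by (auto simp: free_module_simps)
qed

lemma free_module_map_closed:
  assumes "c \<in> carrier (free_module R X)" and "f \<in> carrier R \<rightarrow> carrier R" and "f \<zero> = \<zero>"
  shows "(\<lambda>x. f (c x)) \<in> carrier (free_module R X)"
proof -
  have "finite {x. f (c x) \<noteq> \<zero>}"
    by (rule finite_subset[of _ "{x. c x \<noteq> \<zero>}"]) (use assms in \<open>auto simp: free_module_simps\<close>)
  then show ?thesis using assms by (auto simp: free_module_simps)
qed

lemma free_module_operator_group: "operator_group R (free_module R X)"
proof (intro operator_group.intro abelian_groupI operator_group_axioms.intro)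
  fix c assume c: "c \<in> carrier (free_module R X)"
  then show "\<exists>d\<in>carrier (free_module R X). d \<oplus>\<^bsub>free_module R X\<^esub> c = \<zero>\<^bsub>free_module R X\<^esub>"
    using free_module_map_closed[OF c, of "\<lambda>a. \<ominus> a"] free_module_coeff[OF c]
    by (auto intro!: bexI[of _ "\<lambda>x. \<ominus> c x"] simp: free_module_simps(2,3) l_neg)
  show "r \<odot>\<^bsub>free_module R X\<^esub> c \<in> carrier (free_module R X)" if "r \<in> carrier R" for r
    using free_module_map_closed[OF c, of "\<lambda>a. r \<otimes> a"] that by (simp add: free_module_simps(4))
qed (auto simp: free_module_simps(2-4) free_module_add_closed free_module_coeff a_assoc a_comm a_lcomm
    r_distr intro!: ext, simp add: free_module_simps)

lemma free_module_a_inv: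
  assumes "c \<in> carrier (free_module R X)"
  shows "\<ominus>\<^bsub>free_module R X\<^esub> c = (\<lambda>x. \<ominus> c x)"
proof -
  interpret F: operator_group R "free_module R X" by (rule free_module_operator_group)
  show ?thesis
    using assms free_module_map_closed[OF assms, of "\<lambda>a. \<ominus> a"] free_module_coeff[OF assms]
    by (intro F.minus_equality) (auto simp: free_module_simps(2,3) l_neg)
qed

lemma free_module_subset:
  assumes "X \<subseteq> Y"
  shows "carrier (free_module R X) \<subseteq> carrier (free_module R Y)"
proof
  fix c assume c: "c \<in> carrier (free_module R X)"
  then show "c \<in> carrier (free_module R Y)"
    using free_module_coeff[OF c] assms by (auto simp: free_module_simps)
qed

lemma free_module_submodule:
  assumes "X \<subseteq> Y"
  shows "submodule (carrier (free_module R X)) R (free_module R Y)"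
proof -
  interpret X: operator_group R "free_module R X" by (rule free_module_operator_group)
  interpret Y: operator_group R "free_module R Y" by (rule free_module_operator_group)
  note sub = free_module_subset[OF assms]
  show ?thesis
  proof (rule Y.submoduleI[OF sub])
    show "\<zero>\<^bsub>free_module R Y\<^esub> \<in> carrier (free_module R X)"
      using X.zero_closed by (simp add: free_module_simps(2))
    fix c assume c: "c \<in> carrier (free_module R X)"
    then show "\<ominus>\<^bsub>free_module R Y\<^esub> c \<in> carrier (free_module R X)"
      using X.a_inv_closed[OF c] sub by (auto simp: free_module_a_inv)
    show "r \<odot>\<^bsub>free_module R Y\<^esub> c \<in> carrier (free_module R X)" if "r \<in> carrier R" for r
      using X.smult_closed[OF that c] by (simp add: free_module_simps(4))
    show "c \<oplus>\<^bsub>free_module R Y\<^esub> d \<in> carrier (free_module R X)"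
      if "d \<in> carrier (free_module R X)" for d
      using X.a_closed[OF c that] by (simp add: free_module_simps(3))
  qed
qed

text \<open>This translates between the powers of -1 in \<open>boundary\<close> and the parity test
  in \<open>face_contraction\<close>.\<close>

lemma minus_one_power_mult:
  assumes "c \<in> carrier R"
  shows "(\<ominus> \<one>) [^] (k::nat) \<otimes> c = (if even k then c else \<ominus> c)"
proof (induction k)
  case (Suc k)
  have "(\<ominus> \<one>) [^] Suc k \<otimes> c = \<ominus> ((\<ominus> \<one>) [^] k \<otimes> c)"
    using assms by (simp add: r_minus l_minus)
  then show ?case using Suc assms by simp
qed (use assms in simp)

end

text \<open>
  Interior multiplication by the vertex \<open>v\<close>: the boundary operator is the sum of these operators over
  all vertices, and they anticommute and square to zero.
\<close>

definition face_contraction ::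
  "('a, 'r) ring_scheme \<Rightarrow> 'v::linorder \<Rightarrow> ('v set \<Rightarrow> 'a) \<Rightarrow> 'v set \<Rightarrow> 'a" where
  "face_contraction R v c \<tau> =
     (if v \<in> \<tau> then \<zero>\<^bsub>R\<^esub>
      else if even (card {w\<in>\<tau>. w < v}) then c (insert v \<tau>) else \<ominus>\<^bsub>R\<^esub> c (insert v \<tau>))"

text \<open>The vertex set is a parameter because a sum over all vertices of an infinite type would
  only yield a default value. Any finite \<open>V\<close> containing all faces in the support of a
  chain gives its boundary.\<close>

definition partial_boundary ::
  "('a, 'r) ring_scheme \<Rightarrow> 'v::linorder set \<Rightarrow> ('v set \<Rightarrow> 'a) \<Rightarrow> 'v set \<Rightarrow> 'a" where
  "partial_boundary R V c \<tau> = (\<Oplus>\<^bsub>R\<^esub>v\<in>V. face_contraction R v c \<tau>)"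

text \<open>The common ambient group: chains of all dimensions and of all complexes on the vertex
  type live in it, and one may apply contractions without keeping track of the complex.\<close>

abbreviation finite_chains :: "('a, 'r) ring_scheme \<Rightarrow> ('a, 'v set \<Rightarrow> 'a) module" where
  "finite_chains R \<equiv> free_module R {\<sigma>. finite \<sigma>}"

section \<open>Calculus of contractions and boundaries\<close>

context ring
begin

lemma face_contraction_nonzero:
  assumes "face_contraction R v c \<tau> \<noteq> \<zero>"
  shows "v \<notin> \<tau>" and "c (insert v \<tau>) \<noteq> \<zero>"
  using assms by (auto simp: face_contraction_def split: if_splits)

lemma face_contraction_closed:
  assumes c: "c \<in> carrier (finite_chains R)"
  shows "face_contraction R v c \<in> carrier (finite_chains R)"
proof -
  have "finite {\<tau>. face_contraction R v c \<tau> \<noteq> \<zero>}"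
  proof (rule finite_subset)
    show "{\<tau>. face_contraction R v c \<tau> \<noteq> \<zero>} \<subseteq> (\<lambda>\<sigma>. \<sigma> - {v}) ` {\<sigma>. c \<sigma> \<noteq> \<zero>}"
    proof
      fix \<tau> assume "\<tau> \<in> {\<tau>. face_contraction R v c \<tau> \<noteq> \<zero>}"
      then have "v \<notin> \<tau>" "c (insert v \<tau>) \<noteq> \<zero>"
        by (auto dest: face_contraction_nonzero)
      then show "\<tau> \<in> (\<lambda>\<sigma>. \<sigma> - {v}) ` {\<sigma>. c \<sigma> \<noteq> \<zero>}"
        by (intro image_eqI[of _ _ "insert v \<tau>"]) auto
    qed
  qed (use c in \<open>simp add: free_module_simps\<close>)
  then show ?thesis
    using free_module_coeff[OF c] c by (auto simp: free_module_simps face_contraction_def)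
qed

lemma face_contraction_linear:
  "face_contraction R v \<in> linear_maps R (finite_chains R) (finite_chains R)"
  by (rule linear_mapsI)
    (auto simp: face_contraction_closed free_module_simps(2-4) face_contraction_def fun_eq_iff
      free_module_coeff minus_add r_minus)

text \<open>For distinct vertices outside \<tau>, adding \<open>v\<close> changes the position of
  \<open>u\<close> exactly if \<open>v < u\<close>, and adding \<open>u\<close> changes that of
  \<open>v\<close> exactly if \<open>u < v\<close>. One of the two holds, so the terms have opposite
  signs. For \<open>u = v\<close> both terms vanish.\<close>

lemma face_contraction_anticommute:
  assumes c: "c \<in> carrier (finite_chains R)"
  shows "face_contraction R u (face_contraction R v c) \<tau> \<oplus>
         face_contraction R v (face_contraction R u c) \<tau> = \<zero>"
proof (cases "finite \<tau> \<and> u \<noteq> v \<and> u \<notin> \<tau> \<and> v \<notin> \<tau>")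
  case True
  have "{w \<in> insert v \<tau>. w < u} = (if v < u then insert v {w \<in> \<tau>. w < u} else {w \<in> \<tau>. w < u})"
       "{w \<in> insert u \<tau>. w < v} = (if u < v then insert u {w \<in> \<tau>. w < v} else {w \<in> \<tau>. w < v})"
    by auto
  then show ?thesis
    using True free_module_coeff[OF c] insert_commute[of u v \<tau>]
    by (auto simp: face_contraction_def l_neg r_neg)
next
  case False
  \<comment> \<open>For infinite \<tau> the initial segments may be infinite, with
    \<open>card\<close> equal to 0, and counting positions fails; instead \<open>c\<close> vanishes
    on infinite sets.\<close>
  moreover have "c (insert u (insert v \<tau>)) = \<zero>" if "infinite \<tau>"
    using c that by (simp add: free_module_simps)
  ultimately show ?thesis
    by (auto simp: face_contraction_def insert_commute[of u v \<tau>])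
qed

lemma partial_boundary_empty: "partial_boundary R {} c = \<zero>\<^bsub>finite_chains R\<^esub>"
  by (simp add: partial_boundary_def fun_eq_iff free_module_simps)

text \<open>An identity in the chain group rather than at each face, so that the inductions on
  \<open>V\<close> below become calculations with linear operators.\<close>

lemma partial_boundary_insert:
  assumes "finite V" and "v \<notin> V" and c: "c \<in> carrier (finite_chains R)"
  shows "partial_boundary R (insert v V) c =
    face_contraction R v c \<oplus>\<^bsub>finite_chains R\<^esub> partial_boundary R V c"
  unfolding partial_boundary_def free_module_simps(3)
  using assms free_module_coeff[OF face_contraction_closed[OF c]]
  by (subst finsum_insert) auto

lemma partial_boundary_linear:
  assumes "finite V"
  shows "partial_boundary R V \<in> linear_maps R (finite_chains R) (finite_chains R)"
  using assms
proof (induction V)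
  interpret E: operator_group R "finite_chains R :: ('a, 'c set \<Rightarrow> 'a) module"
    by (rule free_module_operator_group)
  case empty
  show ?case
    by (rule linear_mapsI) (simp_all add: partial_boundary_empty E.smult_zero)
next
  interpret E: operator_group R "finite_chains R :: ('a, 'c set \<Rightarrow> 'a) module"
    by (rule free_module_operator_group)
  case (insert v V)
  note * = linear_mapsD[OF insert.IH] linear_mapsD[OF face_contraction_linear]
  show ?case
    by (rule linear_mapsI)
      (use insert.hyps in \<open>simp_all add: partial_boundary_insert * E.smult_closed E.smult_r_distr
        E.a_assoc E.a_lcomm\<close>)
qed

text \<open>Anticommutation with each vertex of \<open>V\<close>, summed up. This includes the case
  that \<open>u\<close> lies in \<open>V\<close>, because contraction with \<open>u\<close> squares
  to zero and so anticommutes with itself.\<close>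

lemma face_contraction_partial_boundary:
  assumes "finite V" and c: "c \<in> carrier (finite_chains R)"
  shows "face_contraction R u (partial_boundary R V c) =
    \<ominus>\<^bsub>finite_chains R\<^esub> partial_boundary R V (face_contraction R u c)"
  using assms(1)
proof (induction V)
  interpret E: operator_group R "finite_chains R :: ('a, 'c set \<Rightarrow> 'a) module"
    by (rule free_module_operator_group)
  case empty
  show ?case
    unfolding partial_boundary_empty
      E.linear_maps_zero[OF E.operator_group_axioms face_contraction_linear]
    by (rule E.minus_equality[symmetric]) simp_all
next
  interpret E: operator_group R "finite_chains R :: ('a, 'c set \<Rightarrow> 'a) module"
    by (rule free_module_operator_group)
  case (insert v V)
  let ?E = "finite_chains R :: ('a, 'c set \<Rightarrow> 'a) module"
  note lin = linear_mapsD[OF partial_boundary_linear[OF insert.hyps(1)]]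
    linear_mapsD[OF face_contraction_linear]
  have closed: "face_contraction R w x \<in> carrier ?E" if "x \<in> carrier ?E" for w x
    using that by (rule face_contraction_closed)
  have swap: "face_contraction R u (face_contraction R v c) =
      \<ominus>\<^bsub>?E\<^esub> face_contraction R v (face_contraction R u c)"
    by (rule E.minus_equality[symmetric])
      (use face_contraction_anticommute[OF c] closed c in \<open>auto simp: free_module_simps(2,3)\<close>)
  show ?case
    using c closed insert.hyps
    by (simp add: partial_boundary_insert lin insert.IH swap E.minus_add)
qed

text \<open>
  Induction on \<open>V\<close>, using the anticommutation with one further vertex, avoids any division by 2.
\<close>

lemma partial_boundary_twice:
  assumes "finite V" and c: "c \<in> carrier (finite_chains R)"
  shows "partial_boundary R V (partial_boundary R V c) = \<zero>\<^bsub>finite_chains R\<^esub>"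
  using assms(1)
proof (induction V)
  case empty
  show ?case by (simp add: partial_boundary_empty)
next
  interpret E: operator_group R "finite_chains R :: ('a, 'c set \<Rightarrow> 'a) module"
    by (rule free_module_operator_group)
  case (insert v V)
  let ?E = "finite_chains R :: ('a, 'c set \<Rightarrow> 'a) module"
  let ?d = "partial_boundary R V" and ?p = "face_contraction R v"
  note lin = linear_mapsD[OF partial_boundary_linear[OF insert.hyps(1)]]
    linear_mapsD[OF face_contraction_linear]
  have "?p (?p c) = \<zero>\<^bsub>?E\<^esub>"
    by (simp add: fun_eq_iff face_contraction_def free_module_simps)
  moreover have "?p (?d c) = \<ominus>\<^bsub>?E\<^esub> ?d (?p c)"
    by (rule face_contraction_partial_boundary[OF insert.hyps(1) c])
  ultimately show ?case
    using c insert.hyps insert.IH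
    by (simp add: partial_boundary_insert lin E.l_neg)
qed

text \<open>For fixed \<tau>, a face of the support has a nonempty inner sum only if it is
  \<open>insert v \<tau>\<close> with \<open>v\<close> outside \<tau>, and then \<open>v\<close> is
  the only index of that sum. As \<open>v\<close> is determined by the face, the double sum can be
  reindexed as a sum over vertices.\<close>

lemma boundary_eq_partial_boundary:
  assumes c: "c \<in> carrier (finite_chains R)" and V: "finite V" "{\<sigma>. c \<sigma> \<noteq> \<zero>} \<subseteq> Pow V"
  shows "boundary R c = partial_boundary R V c"
proof
  fix \<tau>
  let ?S = "{\<sigma>. c \<sigma> \<noteq> \<zero>}"
  let ?g = "\<lambda>\<sigma>. \<Oplus>v\<in>{v\<in>\<sigma>. \<sigma> - {v} = \<tau>}. (\<ominus> \<one>) [^] card {w\<in>\<sigma>. w < v} \<otimes> c \<sigma>"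
  let ?W = "{v \<in> V - \<tau>. c (insert v \<tau>) \<noteq> \<zero>}"
  have coeff: "c \<sigma> \<in> carrier R" for \<sigma> by (rule free_module_coeff[OF c])
  have finS: "finite ?S" using c by (simp add: free_module_simps)
  have closed: "face_contraction R v c \<tau> \<in> carrier R" for v
    by (rule free_module_coeff[OF face_contraction_closed[OF c]])
  have g: "?g (insert v \<tau>) = face_contraction R v c \<tau>" if "v \<notin> \<tau>" for v
  proof -
    have "{u \<in> insert v \<tau>. insert v \<tau> - {u} = \<tau>} = {v}" using that by auto
    moreover have "{w \<in> insert v \<tau>. w < v} = {w \<in> \<tau>. w < v}" by auto
    ultimately show ?thesis
      using that coeff by (simp add: face_contraction_def minus_one_power_mult)
  qed
  have face_contraction_zero: "face_contraction R v c \<tau> = \<zero>" if "v \<in> \<tau> \<or> c (insert v \<tau>) = \<zero>" for v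
    using that by (auto simp: face_contraction_def)
  have g_closed: "?g \<sigma> \<in> carrier R" for \<sigma>
    using coeff by (intro finsum_closed) auto
  have g_zero: "?g \<sigma> = \<zero>" if "\<sigma> \<in> ?S - (\<lambda>v. insert v \<tau>) ` ?W" for \<sigma>
  proof -
    have "{v \<in> \<sigma>. \<sigma> - {v} = \<tau>} = {}"
    proof (rule ccontr)
      assume "{v \<in> \<sigma>. \<sigma> - {v} = \<tau>} \<noteq> {}"
      then obtain v where "v \<in> \<sigma>" "\<sigma> - {v} = \<tau>" by blast
      then have "\<sigma> = insert v \<tau>" "v \<notin> \<tau>" by auto
      then show False using that V(2) by auto
    qed
    then show ?thesis by (simp only: finsum_empty)
  qed
  have "boundary R c \<tau> = (\<Oplus>\<sigma>\<in>?S. ?g \<sigma>)" by (simp add: boundary_def)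
  also have "\<dots> = (\<Oplus>\<sigma>\<in>(\<lambda>v. insert v \<tau>) ` ?W. ?g \<sigma>)"
    by (rule add.finprod_mono_neutral_cong_right) (use finS g_zero g_closed in auto)
  also have "\<dots> = (\<Oplus>v\<in>?W. ?g (insert v \<tau>))"
    by (rule finsum_reindex) (use g_closed in \<open>auto simp: inj_on_def\<close>)
  also have "\<dots> = (\<Oplus>v\<in>V. face_contraction R v c \<tau>)"
    by (rule add.finprod_mono_neutral_cong_left[OF V(1)])
    (use closed g in \<open>auto simp: face_contraction_zero\<close>)
  finally show "boundary R c \<tau> = partial_boundary R V c \<tau>" by (simp add: partial_boundary_def)
qed

lemma finite_chains_vertices:
  assumes "c \<in> carrier (finite_chains R)"
  shows "\<exists>V. finite V \<and> {\<sigma>. c \<sigma> \<noteq> \<zero>} \<subseteq> Pow V"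
proof (intro exI conjI)
  show "finite (\<Union>{\<sigma>. c \<sigma> \<noteq> \<zero>})"
    using assms by (intro finite_Union) (auto simp: free_module_simps)
qed auto

lemma partial_boundary_support:
  assumes "partial_boundary R V c \<tau> \<noteq> \<zero>"
  obtains v where "v \<in> V" and "v \<notin> \<tau>" and "c (insert v \<tau>) \<noteq> \<zero>"
proof -
  have "\<exists>v\<in>V. face_contraction R v c \<tau> \<noteq> \<zero>"
  proof (rule ccontr)
    assume "\<not> ?thesis"
    then have "partial_boundary R V c \<tau> = (\<Oplus>v\<in>V. \<zero>)"
      unfolding partial_boundary_def by (intro finsum_cong') auto
    then show False using assms by simp
  qed
  then obtain v where v: "v \<in> V" "face_contraction R v c \<tau> \<noteq> \<zero>" by blast
  show ?thesis by (rule that[OF v(1) face_contraction_nonzero[OF v(2)]])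
qed

lemma boundary_linear: "boundary R \<in> linear_maps R (finite_chains R) (finite_chains R)"
proof (rule linear_mapsI)
  interpret E: operator_group R "finite_chains R :: ('a, 'c set \<Rightarrow> 'a) module"
    by (rule free_module_operator_group)
  fix c :: "'c set \<Rightarrow> 'a" assume c: "c \<in> carrier (finite_chains R)"
  obtain V where V: "finite V" "{\<sigma>. c \<sigma> \<noteq> \<zero>} \<subseteq> Pow V"
    using finite_chains_vertices[OF c] by blast
  note lin = linear_mapsD[OF partial_boundary_linear[OF V(1)]]
  have eq: "boundary R c = partial_boundary R V c"
    by (rule boundary_eq_partial_boundary[OF c V])
  show "boundary R c \<in> carrier (finite_chains R)" unfolding eq by (rule lin(1)[OF c])
  show "boundary R (r \<odot>\<^bsub>finite_chains R\<^esub> c) = r \<odot>\<^bsub>finite_chains R\<^esub> boundary R c"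
    if r: "r \<in> carrier R" for r
    unfolding eq lin(3)[OF r c, symmetric]
    by (rule boundary_eq_partial_boundary[OF E.smult_closed[OF r c] V(1)])
      (rule subset_trans[OF _ V(2)], use r in \<open>auto simp: free_module_simps(4)\<close>)
  fix d :: "'c set \<Rightarrow> 'a" assume d: "d \<in> carrier (finite_chains R)"
  obtain W where W: "finite W" "{\<sigma>. d \<sigma> \<noteq> \<zero>} \<subseteq> Pow W"
    using finite_chains_vertices[OF d] by blast
  \<comment> \<open>Additivity compares three boundaries, which requires one vertex set serving both
    chains and their sum.\<close>
  define U where "U = V \<union> W"
  have U: "finite U" "{\<sigma>. c \<sigma> \<noteq> \<zero>} \<subseteq> Pow U" "{\<sigma>. d \<sigma> \<noteq> \<zero>} \<subseteq> Pow U"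
    unfolding U_def using V W by blast+
  have "boundary R (c \<oplus>\<^bsub>finite_chains R\<^esub> d) = partial_boundary R U (c \<oplus>\<^bsub>finite_chains R\<^esub> d)"
    by (rule boundary_eq_partial_boundary[OF E.a_closed[OF c d] U(1)])
      (rule subset_trans[OF _ Un_least[OF U(2,3)]], auto simp: free_module_simps(3))
  then show "boundary R (c \<oplus>\<^bsub>finite_chains R\<^esub> d) = boundary R c \<oplus>\<^bsub>finite_chains R\<^esub> boundary R d"
    using linear_mapsD(2)[OF partial_boundary_linear[OF U(1)] c d]
      boundary_eq_partial_boundary[OF c U(1,2)] boundary_eq_partial_boundary[OF d U(1,3)]
    by simp
qed

lemma boundary_twice:
  assumes c: "c \<in> carrier (finite_chains R)"
  shows "boundary R (boundary R c) = \<zero>\<^bsub>finite_chains R\<^esub>"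
proof -
  obtain V where V: "finite V" "{\<sigma>. c \<sigma> \<noteq> \<zero>} \<subseteq> Pow V"
    using finite_chains_vertices[OF c] by blast
  \<comment> \<open>The same \<open>V\<close> serves again: a face in the support of the boundary
    lies in a face in the support of \<open>c\<close>.\<close>
  have "boundary R (partial_boundary R V c) = partial_boundary R V (partial_boundary R V c)"
    by (rule boundary_eq_partial_boundary[OF linear_mapsD(1)[OF partial_boundary_linear[OF V(1)] c] V(1)])
      (use V(2) in \<open>auto elim!: partial_boundary_support\<close>)
  then show ?thesis
    using boundary_eq_partial_boundary[OF c V] partial_boundary_twice[OF V(1) c] by simp
qed

text \<open>Contraction is a chain map only up to sign, but this suffices for it to send cycles to
  cycles and boundaries to boundaries.\<close>

lemma face_contraction_boundary:
  assumes c: "c \<in> carrier (finite_chains R)"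
  shows "face_contraction R u (boundary R c) =
    \<ominus>\<^bsub>finite_chains R\<^esub> boundary R (face_contraction R u c)"
proof -
  obtain V where V: "finite V" "{\<sigma>. c \<sigma> \<noteq> \<zero>} \<subseteq> Pow V"
    using finite_chains_vertices[OF c] by blast
  have "boundary R (face_contraction R u c) = partial_boundary R V (face_contraction R u c)"
    by (rule boundary_eq_partial_boundary[OF face_contraction_closed[OF c] V(1)])
      (use V(2) in \<open>auto dest!: face_contraction_nonzero\<close>)
  then show ?thesis
    using boundary_eq_partial_boundary[OF c V] face_contraction_partial_boundary[OF V(1) c] by simp
qed

lemma boundary_support:
  assumes c: "c \<in> carrier (finite_chains R)" and "boundary R c \<tau> \<noteq> \<zero>"
  obtains v where "v \<notin> \<tau>" and "c (insert v \<tau>) \<noteq> \<zero>"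
proof -
  obtain V where V: "finite V" "{\<sigma>. c \<sigma> \<noteq> \<zero>} \<subseteq> Pow V"
    using finite_chains_vertices[OF c] by blast
  have "partial_boundary R V c \<tau> \<noteq> \<zero>"
    using assms(2) boundary_eq_partial_boundary[OF c V] by simp
  then show ?thesis by (rule partial_boundary_support) (rule that)
qed

end

section \<open>Deleting pairwise non-adjacent vertices\<close>

text \<open>Needed because the links are identified with smaller matching complexes only for indices
  in the range of summation.\<close>

lemma direct_sum_cong:
  assumes "\<And>i. i \<in> I \<Longrightarrow> M i = N i"
  shows "direct_sum I M = direct_sum I N"
proof -
  have "(\<Pi>\<^sub>E i\<in>I. carrier (M i)) = (\<Pi>\<^sub>E i\<in>I. carrier (N i))"
    by (rule PiE_cong) (simp add: assms)
  moreover have "{i \<in> I. f i \<noteq> \<zero>\<^bsub>M i\<^esub>} = {i \<in> I. f i \<noteq> \<zero>\<^bsub>N i\<^esub>}" for f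
    by (auto simp: assms)
  ultimately show ?thesis
    unfolding direct_sum_def by (simp add: assms cong: restrict_cong)
qed

section \<open>Links, deletions and their chains\<close>

definition link :: "'v set set \<Rightarrow> 'v \<Rightarrow> 'v set set" where
  "link K v = {\<tau>. v \<notin> \<tau> \<and> insert v \<tau> \<in> K}"

lemma simplicial_complex_link:
  assumes "simplicial_complex K" and "{v} \<in> K"
  shows "simplicial_complex (link K v)"
  unfolding simplicial_complex_def link_def
proof (intro conjI ballI allI impI)
  show "finite \<sigma>" if "\<sigma> \<in> {\<tau>. v \<notin> \<tau> \<and> insert v \<tau> \<in> K}" for \<sigma>
  proof -
    from that assms(1) have "finite (insert v \<sigma>)" unfolding simplicial_complex_def by blast
    then show ?thesis by simp
  qed
  show "\<tau> \<in> {\<tau>. v \<notin> \<tau> \<and> insert v \<tau> \<in> K}"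
    if "\<sigma> \<in> {\<tau>. v \<notin> \<tau> \<and> insert v \<tau> \<in> K}" "\<tau> \<subseteq> \<sigma>" for \<sigma> \<tau>
    using that assms(1) insert_mono[OF that(2), of v] unfolding simplicial_complex_def by blast
qed (use assms(2) in simp)

lemma faces_diff:
  assumes "simplicial_complex K" and "insert v \<tau> \<in> faces K d" and "v \<notin> \<tau>"
  shows "\<tau> \<in> faces K (d - 1)"
proof -
  have "\<tau> \<in> K" using assms unfolding simplicial_complex_def faces_def by blast
  then show ?thesis using assms(2,3) by (auto simp: faces_def)
qed

lemma faces_link:
  assumes "v \<notin> \<tau>" and "insert v \<tau> \<in> faces K (d + 1)"
  shows "\<tau> \<in> faces (link K v) d"
  using assms by (auto simp: faces_def link_def)

context ring
begin

text \<open>Membership in a chain group becomes a condition on the support of a finite chain, which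
  is all that has to be tracked when operators are applied.\<close>

lemma chains_iff:
  "c \<in> carrier (chains R K d) \<longleftrightarrow>
     c \<in> carrier (finite_chains R) \<and> (\<forall>\<sigma>. c \<sigma> \<noteq> \<zero> \<longrightarrow> \<sigma> \<in> faces K d)"
proof -
  have "faces K d \<subseteq> {\<sigma>. finite \<sigma>}" by (auto simp: faces_def)
  then have "carrier (chains R K d) \<subseteq> carrier (finite_chains R)"
    unfolding chains_def by (rule free_module_subset)
  then have "c \<in> carrier (finite_chains R)" if "c \<in> carrier (chains R K d)"
    using that by blast
  moreover have "c \<in> carrier (chains R K d) \<longleftrightarrow> (\<forall>\<sigma>. c \<sigma> \<noteq> \<zero> \<longrightarrow> \<sigma> \<in> faces K d)"
    if c: "c \<in> carrier (finite_chains R)"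
    using free_module_coeff[OF c] c unfolding chains_def free_module_simps by blast
  ultimately show ?thesis by blast
qed

lemma chains_submodule: "submodule (carrier (chains R K d)) R (finite_chains R)"
  unfolding chains_def by (rule free_module_submodule) (auto simp: faces_def)

lemma boundary_chains:
  assumes "simplicial_complex K" and c: "c \<in> carrier (chains R K d)"
  shows "boundary R c \<in> carrier (chains R K (d - 1))"
proof -
  from c have c: "c \<in> carrier (finite_chains R)" "\<And>\<sigma>. c \<sigma> \<noteq> \<zero> \<Longrightarrow> \<sigma> \<in> faces K d"
    by (auto simp: chains_iff)
  show ?thesis
    unfolding chains_iff
    using linear_mapsD(1)[OF boundary_linear c(1)] c(2)
    by (auto elim!: boundary_support[OF c(1)] intro: faces_diff[OF assms(1)])
qed

text \<open>The records \<open>chains R K d\<close> and \<open>finite_chains R\<close> differ only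
  in their carriers. Once these are replaced by the cycles, both homology modules are literally
  equal, not just isomorphic.\<close>

lemma reduced_homology_eq:
  "reduced_homology R K = homology (finite_chains R) (boundary R) (\<lambda>d. carrier (chains R K d))"
  by (rule ext)
    (simp add: reduced_homology_def homology_def cycles_def boundaries_def a_kernel_def kernel_def
      chains_def free_module_def)

lemma face_contraction_chains:
  assumes c: "c \<in> carrier (chains R K (d + 1))"
  shows "face_contraction R v c \<in> carrier (chains R (link K v) d)"
  unfolding chains_iff
proof (intro conjI allI impI)
  show "face_contraction R v c \<in> carrier (finite_chains R)"
    using c by (intro face_contraction_closed) (simp add: chains_iff)
  fix \<tau> assume "face_contraction R v c \<tau> \<noteq> \<zero>"
  note nz = face_contraction_nonzero[OF this]
  show "\<tau> \<in> faces (link K v) d"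
    using c nz(2) by (intro faces_link[OF nz(1)]) (simp add: chains_iff)
qed

text \<open>The coefficient of a face containing \<open>v\<close> reappears, up to sign, in the
  contraction with \<open>v\<close> at the face without \<open>v\<close>. Chains of the deletion
  thus become the common kernel of contractions, in which form they can be combined with the
  boundary.\<close>

lemma chains_deletion_iff:
  assumes c: "c \<in> carrier (chains R K d)"
  shows "c \<in> carrier (chains R {\<sigma> \<in> K. \<forall>v\<in>W. v \<notin> \<sigma>} d) \<longleftrightarrow>
    (\<forall>v\<in>W. face_contraction R v c = \<zero>\<^bsub>finite_chains R\<^esub>)"
proof
  assume L: "c \<in> carrier (chains R {\<sigma> \<in> K. \<forall>v\<in>W. v \<notin> \<sigma>} d)"
  show "\<forall>v\<in>W. face_contraction R v c = \<zero>\<^bsub>finite_chains R\<^esub>"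
  proof (intro ballI ext)
    fix v \<tau> assume v: "v \<in> W"
    show "face_contraction R v c \<tau> = \<zero>\<^bsub>finite_chains R\<^esub> \<tau>"
    proof (rule ccontr)
      assume "face_contraction R v c \<tau> \<noteq> \<zero>\<^bsub>finite_chains R\<^esub> \<tau>"
      then have "c (insert v \<tau>) \<noteq> \<zero>"
        by (auto simp: free_module_simps(2) dest: face_contraction_nonzero)
      then show False using L v by (auto simp: chains_iff faces_def)
    qed
  qed
next
  assume zero: "\<forall>v\<in>W. face_contraction R v c = \<zero>\<^bsub>finite_chains R\<^esub>"
  from c have c': "c \<in> carrier (finite_chains R)" "\<And>\<sigma>. c \<sigma> \<noteq> \<zero> \<Longrightarrow> \<sigma> \<in> faces K d"
    by (auto simp: chains_iff)
  have "v \<notin> \<sigma>" if "c \<sigma> \<noteq> \<zero>" "v \<in> W" for v \<sigma>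
  proof
    assume "v \<in> \<sigma>"
    then have "insert v (\<sigma> - {v}) = \<sigma>" by auto
    moreover have "face_contraction R v c (\<sigma> - {v}) = \<zero>"
      using zero that(2) by (simp add: free_module_simps(2))
    ultimately have "c \<sigma> = \<zero> \<or> \<ominus> c \<sigma> = \<zero>"
      by (auto simp: face_contraction_def split: if_splits)
    then show False using that(1) free_module_coeff[OF c'(1), of \<sigma>] minus_minus[of "c \<sigma>"] by auto
  qed
  then show "c \<in> carrier (chains R {\<sigma> \<in> K. \<forall>v\<in>W. v \<notin> \<sigma>} d)"
    using c' by (auto simp: chains_iff faces_def)
qed

text \<open>
  Every face contains at most one of the vertices \<open>e i\<close>, so the faces containing \<open>e i\<close> for distinct
  \<open>i\<close> can be treated independently; each coefficient of the lift comes from a single \<open>y i\<close>.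
\<close>

lemma face_contraction_lift:
  assumes "finite I" and adj: "\<And>\<sigma> i j. \<lbrakk>\<sigma> \<in> K; i \<in> I; j \<in> I; e i \<in> \<sigma>; e j \<in> \<sigma>\<rbrakk> \<Longrightarrow> i = j"
    and y: "\<And>i. i \<in> I \<Longrightarrow> y i \<in> carrier (chains R (link K (e i)) d)"
  shows "\<exists>c\<in>carrier (chains R K (d + 1)). \<forall>i\<in>I. face_contraction R (e i) c = y i"
proof -
  define k where "k \<sigma> = (THE i. i \<in> I \<and> e i \<in> \<sigma>)" for \<sigma>
  have k: "k \<sigma> = i" if "\<sigma> \<in> K" "i \<in> I" "e i \<in> \<sigma>" for \<sigma> i
    unfolding k_def
  proof (rule the_equality)
    show "j = i" if "j \<in> I \<and> e j \<in> \<sigma>" for j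
      using that \<open>\<sigma> \<in> K\<close> \<open>i \<in> I\<close> \<open>e i \<in> \<sigma>\<close> by (intro adj[of \<sigma> j i]) auto
  qed (use that in simp)
  \<comment> \<open>The sign that contraction with \<open>e i\<close> is going to introduce is
    applied in advance, so that the two cancel.\<close>
  define s where "s i \<tau> = (if even (card {w\<in>\<tau>. w < e i}) then y i \<tau> else \<ominus> y i \<tau>)" for i \<tau>
  define c where
    "c \<sigma> = (if \<sigma> \<in> K \<and> (\<exists>i\<in>I. e i \<in> \<sigma>) then s (k \<sigma>) (\<sigma> - {e (k \<sigma>)}) else \<zero>)" for \<sigma>
  have y': "y i \<in> carrier (finite_chains R)" "\<And>\<tau>. y i \<tau> \<noteq> \<zero> \<Longrightarrow> \<tau> \<in> faces (link K (e i)) d"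
    if "i \<in> I" for i
    using y[OF that] by (auto simp: chains_iff)
  have coeff: "y i \<tau> \<in> carrier R" if "i \<in> I" for i \<tau>
    by (rule free_module_coeff[OF y'(1)[OF that]])
  have c_eq: "c \<sigma> = s i (\<sigma> - {e i})" if "\<sigma> \<in> K" "i \<in> I" "e i \<in> \<sigma>" for \<sigma> i
    using that k[OF that] by (auto simp: c_def)
  have c_nonzero: "\<exists>i\<in>I. e i \<in> \<sigma> \<and> \<sigma> \<in> K \<and> y i (\<sigma> - {e i}) \<noteq> \<zero>" if "c \<sigma> \<noteq> \<zero>" for \<sigma>
  proof -
    from that obtain i where i: "\<sigma> \<in> K" "i \<in> I" "e i \<in> \<sigma>"
      by (auto simp: c_def split: if_splits)
    moreover have "y i (\<sigma> - {e i}) \<noteq> \<zero>"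
      using that unfolding c_eq[OF i] s_def by (metis minus_zero)
    ultimately show ?thesis by blast
  qed
  have c_faces: "\<sigma> \<in> faces K (d + 1)" if "c \<sigma> \<noteq> \<zero>" for \<sigma>
  proof -
    from c_nonzero[OF that] obtain i where i: "i \<in> I" "e i \<in> \<sigma>" "\<sigma> \<in> K" "y i (\<sigma> - {e i}) \<noteq> \<zero>"
      by blast
    have "finite (\<sigma> - {e i})" "int (card (\<sigma> - {e i})) = d + 1"
      using y'(2)[OF i(1,4)] by (auto simp: faces_def)
    moreover have "card \<sigma> = Suc (card (\<sigma> - {e i}))"
      using i(2) calculation(1) by (intro card.remove) auto
    ultimately show ?thesis using i(3) by (simp add: faces_def)
  qed
  have "finite {\<sigma>. c \<sigma> \<noteq> \<zero>}"
  proof (rule finite_subset)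
    show "{\<sigma>. c \<sigma> \<noteq> \<zero>} \<subseteq> (\<Union>i\<in>I. insert (e i) ` {\<tau>. y i \<tau> \<noteq> \<zero>})"
    proof
      fix \<sigma> assume "\<sigma> \<in> {\<sigma>. c \<sigma> \<noteq> \<zero>}"
      then obtain i where i: "i \<in> I" "e i \<in> \<sigma>" "y i (\<sigma> - {e i}) \<noteq> \<zero>"
        using c_nonzero by blast
      then have "\<sigma> \<in> insert (e i) ` {\<tau>. y i \<tau> \<noteq> \<zero>}"
        by (intro image_eqI[of _ _ "\<sigma> - {e i}"]) auto
      then show "\<sigma> \<in> (\<Union>i\<in>I. insert (e i) ` {\<tau>. y i \<tau> \<noteq> \<zero>})" using i(1) by blast
    qed
    show "finite (\<Union>i\<in>I. insert (e i) ` {\<tau>. y i \<tau> \<noteq> \<zero>})"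
      using assms(1) y'(1) by (auto simp: free_module_simps)
  qed
  moreover have "c \<sigma> \<in> carrier R" for \<sigma>
  proof (cases "\<sigma> \<in> K \<and> (\<exists>i\<in>I. e i \<in> \<sigma>)")
    case True
    then obtain i where "\<sigma> \<in> K" "i \<in> I" "e i \<in> \<sigma>" by blast
    from c_eq[OF this] coeff[OF this(2)] show ?thesis by (simp add: s_def)
  qed (auto simp: c_def)
  ultimately have "c \<in> carrier (chains R K (d + 1))"
    using c_faces by (auto simp: chains_def free_module_simps)
  moreover have "face_contraction R (e i) c = y i" if i: "i \<in> I" for i
  proof
    fix \<tau>
    show "face_contraction R (e i) c \<tau> = y i \<tau>"
    proof (cases "\<tau> \<in> link K (e i)")
      case True
      then have \<tau>: "e i \<notin> \<tau>" "insert (e i) \<tau> \<in> K" by (auto simp: link_def)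
      then have "c (insert (e i) \<tau>) = s i \<tau>"
        using c_eq[OF \<tau>(2) i] by simp
      then show ?thesis
        using \<tau>(1) coeff[OF i] by (auto simp: face_contraction_def s_def)
    next
      case False
      then have "e i \<in> \<tau> \<or> c (insert (e i) \<tau>) = \<zero>" by (auto simp: link_def c_def)
      moreover have "y i \<tau> = \<zero>" using False y'(2)[OF i, of \<tau>] by (auto simp: faces_def)
      ultimately show ?thesis by (auto simp: face_contraction_def)
    qed
  qed
  ultimately show ?thesis by blast
qed

text \<open>The contractions with all \<open>e i\<close> together map the chains of \<open>K\<close>
  onto the families of chains of the links, with the chains of the deletion as kernel. Since they
  anticommute with the boundary, they carry relative cycles and relative boundaries to families of
  cycles and boundaries of the links. Below, \<open>e s\<close> will be the edge
  \<open>(s, 1)\<close>.\<close>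

theorem deletion_long_exact_sequence:
  fixes K :: "'v::linorder set set" and e :: "'i \<Rightarrow> 'v"
  assumes K: "simplicial_complex K" and "finite I" and vertex: "\<And>i. i \<in> I \<Longrightarrow> {e i} \<in> K"
    and adj: "\<And>\<sigma> i j. \<lbrakk>\<sigma> \<in> K; i \<in> I; j \<in> I; e i \<in> \<sigma>; e j \<in> \<sigma>\<rbrakk> \<Longrightarrow> i = j"
  shows "\<exists>f g h. long_exact_sequence R
    (\<lambda>d. direct_sum I (\<lambda>i. reduced_homology R (link K (e i)) d))
    (reduced_homology R {\<sigma> \<in> K. \<forall>i\<in>I. e i \<notin> \<sigma>})
    (reduced_homology R K) f g h"
proof -
  let ?E = "finite_chains R :: ('a, 'v set \<Rightarrow> 'a) module" and ?b = "boundary R"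
  define L where "L = {\<sigma> \<in> K. \<forall>i\<in>I. e i \<notin> \<sigma>}"
  define CK where "CK d = carrier (chains R K d)" for d
  define CL where "CL d = carrier (chains R L d)" for d
  define Lk where "Lk i d = carrier (chains R (link K (e i)) d)" for i d
  define Z where "Z i d = {z \<in> Lk i d. ?b z = \<zero>\<^bsub>?E\<^esub>}" for i d
  define H where "H i = reduced_homology R (link K (e i))" for i
  define cls where "cls i = homology_class ?E ?b (Lk i)" for i
  let ?p = "\<lambda>i. face_contraction R (e i)"
  \<comment> \<open>\<open>q d\<close> identifies the relative homology of \<open>(K, L)\<close> in degree \<open>d + 1\<close> with the direct sum.\<close>
  define q where "q d x = (\<lambda>i\<in>I. cls i d (?p i x))" for d x
  have E: "operator_group R ?E" by (rule free_module_operator_group)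
  interpret E: operator_group R ?E by (rule E)
  note bnd = linear_mapsD[OF boundary_linear]
  have CK: "submodule (CK d) R ?E" for d unfolding CK_def by (rule chains_submodule)
  have Lk: "submodule (Lk i d) R ?E" for i d unfolding Lk_def by (rule chains_submodule)
  note CK' = submoduleD[OF CK] and Lk' = submoduleD[OF Lk]
  have L: "simplicial_complex L"
    using K unfolding L_def simplicial_complex_def by blast
  have bCK: "?b x \<in> CK (d - 1)" if "x \<in> CK d" for x d
    using boundary_chains[OF K] that by (simp add: CK_def)
  have bLk: "?b x \<in> Lk i (d - 1)" if "i \<in> I" "x \<in> Lk i d" for x i d
    using boundary_chains[OF simplicial_complex_link[OF K vertex[OF that(1)]]] that
    by (simp add: Lk_def)
  have CL_iff: "x \<in> CL d \<longleftrightarrow> (\<forall>i\<in>I. ?p i x = \<zero>\<^bsub>?E\<^esub>)" if "x \<in> CK d" for x d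
    using chains_deletion_iff[of x K d "e ` I"] that by (simp add: CK_def CL_def L_def)
  have pCK: "?p i x \<in> Lk i d" if "x \<in> CK (d + 1)" for x i d
    using face_contraction_chains that by (simp add: CK_def Lk_def)
  have pb: "?p i (?b x) = \<ominus>\<^bsub>?E\<^esub> ?b (?p i x)" if "x \<in> CK d" for x i d
    by (rule face_contraction_boundary[OF CK'(1)[OF that]])
  have lift: "\<exists>x\<in>CK (d + 1). \<forall>i\<in>I. ?p i x = y i" if "\<And>i. i \<in> I \<Longrightarrow> y i \<in> Lk i d" for y d
    unfolding CK_def using \<open>finite I\<close> adj that[unfolded Lk_def]
    by (rule face_contraction_lift[of I K e y d])
  \<comment> \<open>The contraction of the boundary is minus the boundary of the contraction, so a
    chain is a relative cycle exactly if all its contractions are cycles.\<close>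
  have bCL_iff: "?b x \<in> CL d \<longleftrightarrow> (\<forall>i\<in>I. ?p i x \<in> Z i d)" if x: "x \<in> CK (d + 1)" for x d
  proof -
    have "?p i (?b x) = \<zero>\<^bsub>?E\<^esub> \<longleftrightarrow> ?p i x \<in> Z i d" for i
    proof -
      have "?b (?p i x) \<in> carrier ?E" using bnd(1) Lk'(1)[OF pCK[OF x]] by blast
      then show ?thesis
        using pb[OF x, of i] pCK[OF x, of i] E.minus_minus[of "?b (?p i x)"]
          E.minus_equality[OF E.l_zero[OF E.zero_closed] E.zero_closed E.zero_closed]
        by (auto simp: Z_def)
    qed
    then show ?thesis using CL_iff[of "?b x" d] bCK[OF x] by simp
  qed
  have H_eq: "H i = homology ?E ?b (Lk i)" for i
    unfolding H_def reduced_homology_eq by (simp add: Lk_def[abs_def])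
  have cls: "cls i d \<in> linear_maps R (?E\<lparr>carrier := Z i d\<rparr>) (H i d)"
    "cls i d ` Z i d = carrier (H i d)"
    "\<And>z. z \<in> Z i d \<Longrightarrow> cls i d z = \<zero>\<^bsub>H i d\<^esub> \<longleftrightarrow> z \<in> ?b ` Lk i (d + 1)"
    if i: "i \<in> I" for i d
  proof -
    have "\<forall>d. submodule (Lk i d) R ?E" "\<forall>d. \<forall>x\<in>Lk i d. ?b x \<in> Lk i (d - 1)"
      using Lk bLk[OF i] by auto
    note * = E boundary_linear boundary_twice this
    show "cls i d \<in> linear_maps R (?E\<lparr>carrier := Z i d\<rparr>) (H i d)"
      "cls i d ` Z i d = carrier (H i d)"
      "\<And>z. z \<in> Z i d \<Longrightarrow> cls i d z = \<zero>\<^bsub>H i d\<^esub> \<longleftrightarrow> z \<in> ?b ` Lk i (d + 1)"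
      using homology_class_linear[OF *] homology_class_image[OF *] homology_class_eq_zero_iff[OF *]
      by (auto simp: cls_def H_eq Z_def)
  qed
  let ?P = "\<lambda>d. direct_sum I (\<lambda>i. H i d)"
  \<comment> \<open>As \<open>I\<close> is finite, the direct sum is the full product, and classes
    can be prescribed independently for each index.\<close>
  have P_carrier: "carrier (?P d) = (\<Pi>\<^sub>E i\<in>I. carrier (H i d))" for d
    using \<open>finite I\<close> by (auto simp: direct_sum_def)
  have "\<exists>f g h. long_exact_sequence R ?P (homology ?E ?b CL) (homology ?E ?b CK) f g h"
  proof (rule long_exact_sequence_of_pair[OF E boundary_linear boundary_twice, where q = q])
    show "submodule (CL d) R ?E" "submodule (CK d) R ?E" for d
      by (simp_all add: CK_def CL_def chains_submodule)
    show "?b x \<in> CL (d - 1)" if "x \<in> CL d" for d x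
      using boundary_chains[OF L] that by (simp add: CL_def)
    show "?b x \<in> CK (d - 1)" if "x \<in> CK d" for d x
      by (rule bCK[OF that])
    show "CL d \<subseteq> CK d" for d
      by (auto simp: CL_def CK_def chains_iff faces_def L_def)
    fix d
    define X where "X = {x \<in> CK (d + 1). ?b x \<in> CL d}"
    have X: "x \<in> CK (d + 1)" "\<And>i. i \<in> I \<Longrightarrow> ?p i x \<in> Z i d" if "x \<in> X" for x
      using that bCL_iff[of x d] by (auto simp: X_def)
    note fc = linear_mapsD[OF face_contraction_linear]
    show "q d \<in> linear_maps R (?E\<lparr>carrier := {x \<in> CK (d + 1). ?b x \<in> CL d}\<rparr>) (?P d)"
      unfolding X_def[symmetric]
    proof (rule linear_mapsI)
      fix x assume "x \<in> carrier (?E\<lparr>carrier := X\<rparr>)"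
      then have x: "x \<in> X" by simp
      have xE: "x \<in> carrier ?E" using X(1)[OF x] CK'(1) by blast
      show "q d x \<in> carrier (?P d)"
        unfolding P_carrier q_def using linear_mapsD(1)[OF cls(1)] X(2)[OF x] by auto
      show "q d (r \<odot>\<^bsub>?E\<lparr>carrier := X\<rparr>\<^esub> x) = r \<odot>\<^bsub>?P d\<^esub> q d x" if "r \<in> carrier R" for r
        using linear_mapsD(3)[OF cls(1) that] X(2)[OF x] fc(3)[OF that xE]
        by (auto simp: q_def direct_sum_def intro!: restrict_ext)
      fix y assume "y \<in> carrier (?E\<lparr>carrier := X\<rparr>)"
      then have y: "y \<in> X" by simp
      have yE: "y \<in> carrier ?E" using X(1)[OF y] CK'(1) by blast
      show "q d (x \<oplus>\<^bsub>?E\<lparr>carrier := X\<rparr>\<^esub> y) = q d x \<oplus>\<^bsub>?P d\<^esub> q d y"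
        using linear_mapsD(2)[OF cls(1)] X(2)[OF x] X(2)[OF y] fc(2)[OF xE yE]
        by (auto simp: q_def direct_sum_def intro!: restrict_ext)
    qed
    have "carrier (?P d) \<subseteq> q d ` X"
    proof
      fix \<phi> assume \<phi>: "\<phi> \<in> carrier (?P d)"
      have "\<forall>i\<in>I. \<exists>z. z \<in> Z i d \<and> cls i d z = \<phi> i"
      proof
        fix i assume i: "i \<in> I"
        then have "\<phi> i \<in> cls i d ` Z i d" using \<phi> by (auto simp: P_carrier cls(2))
        then show "\<exists>z. z \<in> Z i d \<and> cls i d z = \<phi> i" by blast
      qed
      then obtain z where z: "\<And>i. i \<in> I \<Longrightarrow> z i \<in> Z i d" "\<And>i. i \<in> I \<Longrightarrow> cls i d (z i) = \<phi> i"
        using bchoice[of I "\<lambda>i z. z \<in> Z i d \<and> cls i d z = \<phi> i"] by blast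
      \<comment> \<open>One chain of \<open>K\<close> that contracts to all the chosen
        representatives at once; it is a relative cycle because they are cycles.\<close>
      obtain x where x: "x \<in> CK (d + 1)" "\<And>i. i \<in> I \<Longrightarrow> ?p i x = z i"
        using lift[of z d] z(1) by (auto simp: Z_def)
      have "x \<in> X" using x z(1) bCL_iff[OF x(1)] by (simp add: X_def)
      moreover have "\<phi> = q d x"
      proof
        fix i show "\<phi> i = q d x i"
          using x(2) z(2) PiE_arb[OF \<phi>[unfolded P_carrier], of i]
          by (cases "i \<in> I") (simp_all add: q_def)
      qed
      ultimately show "\<phi> \<in> q d ` X" by blast
    qed
    moreover have "q d ` X \<subseteq> carrier (?P d)"
      unfolding P_carrier q_def using linear_mapsD(1)[OF cls(1)] X(2) by auto
    ultimately show "q d ` {x \<in> CK (d + 1). ?b x \<in> CL d} = carrier (?P d)"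
      unfolding X_def by blast
    fix x assume "x \<in> CK (d + 1)" "?b x \<in> CL d"
    then have x: "x \<in> X" by (simp add: X_def)
    note xK = X(1)[OF x] and xZ = X(2)[OF x]
    have xE: "x \<in> carrier ?E" using xK by (rule CK'(1))
    have "q d x = \<zero>\<^bsub>?P d\<^esub> \<longleftrightarrow> (\<forall>i\<in>I. cls i d (?p i x) = \<zero>\<^bsub>H i d\<^esub>)"
      by (auto simp: q_def direct_sum_def restrict_def fun_eq_iff)
    also have "\<dots> \<longleftrightarrow> (\<forall>i\<in>I. ?p i x \<in> ?b ` Lk i (d + 1))"
      using cls(3) xZ by auto
    also have "\<dots> \<longleftrightarrow> (\<exists>y\<in>CK (d + 2). \<exists>a\<in>CL (d + 1). x = ?b y \<oplus>\<^bsub>?E\<^esub> a)"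
    proof
      assume "\<forall>i\<in>I. ?p i x \<in> ?b ` Lk i (d + 1)"
      then have "\<forall>i\<in>I. \<exists>u. u \<in> Lk i (d + 1) \<and> ?p i x = ?b u" by blast
      then obtain u where u: "\<And>i. i \<in> I \<Longrightarrow> u i \<in> Lk i (d + 1)" "\<And>i. i \<in> I \<Longrightarrow> ?p i x = ?b (u i)"
        using bchoice[of I "\<lambda>i u. u \<in> Lk i (d + 1) \<and> ?p i x = ?b u"] by blast
      \<comment> \<open>The sign in \<open>\<ominus> u i\<close> compensates for the
        anticommutation: contracting the boundary of \<open>y\<close> gives the boundary of
        \<open>u i\<close>, which is the contraction of \<open>x\<close>. Hence \<open>x\<close>
        minus the boundary of \<open>y\<close> has vanishing contractions and lies in the
        deletion.\<close>
      obtain y where y: "y \<in> CK (d + 1 + 1)" "\<And>i. i \<in> I \<Longrightarrow> ?p i y = \<ominus>\<^bsub>?E\<^esub> u i"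
        using lift[of "\<lambda>i. \<ominus>\<^bsub>?E\<^esub> u i" "d + 1"] u(1) Lk'(3) by blast
      have byK: "?b y \<in> CK (d + 1)" using bCK[OF y(1)] by (simp only: add_diff_cancel_right')
      note byE = CK'(1)[OF byK]
      define a where "a = x \<oplus>\<^bsub>?E\<^esub> \<ominus>\<^bsub>?E\<^esub> ?b y"
      have aK: "a \<in> CK (d + 1)"
        unfolding a_def by (intro CK'(4) CK'(3) xK byK)
      have "?p i a = \<zero>\<^bsub>?E\<^esub>" if i: "i \<in> I" for i
      proof -
        have uE: "u i \<in> carrier ?E" using u(1)[OF i] by (rule Lk'(1))
        have "?p i (?b y) = ?b (u i)"
          unfolding pb[OF y(1)] y(2)[OF i] E.linear_maps_minus[OF E boundary_linear uE]
          by (rule E.minus_minus) (rule bnd(1)[OF uE])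
        then have "?p i (\<ominus>\<^bsub>?E\<^esub> ?b y) = \<ominus>\<^bsub>?E\<^esub> ?b (u i)"
          using E.linear_maps_minus[OF E face_contraction_linear byE] by simp
        then have "?p i a = ?b (u i) \<oplus>\<^bsub>?E\<^esub> \<ominus>\<^bsub>?E\<^esub> ?b (u i)"
          unfolding a_def fc(2)[OF xE E.a_inv_closed[OF byE]] u(2)[OF i] by simp
        then show ?thesis using E.r_neg[OF bnd(1)[OF uE]] by simp
      qed
      then have "a \<in> CL (d + 1)" using CL_iff[OF aK] by simp
      moreover have "x = ?b y \<oplus>\<^bsub>?E\<^esub> a"
        unfolding a_def using xE byE by (simp add: E.a_lcomm[of "?b y" x] E.r_neg)
      ultimately show "\<exists>y\<in>CK (d + 2). \<exists>a\<in>CL (d + 1). x = ?b y \<oplus>\<^bsub>?E\<^esub> a"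
        using y(1) by (auto simp: add.assoc)
    next
      assume "\<exists>y\<in>CK (d + 2). \<exists>a\<in>CL (d + 1). x = ?b y \<oplus>\<^bsub>?E\<^esub> a"
      then obtain y a where y: "y \<in> CK (d + 1 + 1)" and a: "a \<in> CL (d + 1)" and xa: "x = ?b y \<oplus>\<^bsub>?E\<^esub> a"
        by (auto simp: add.assoc)
      have aK: "a \<in> CK (d + 1)"
        using a by (auto simp: CL_def CK_def chains_iff faces_def L_def)
      note aE = CK'(1)[OF aK] and byE = bnd(1)[OF CK'(1)[OF y]]
      show "\<forall>i\<in>I. ?p i x \<in> ?b ` Lk i (d + 1)"
      proof
        fix i assume i: "i \<in> I"
        have pyL: "?p i y \<in> Lk i (d + 1)" by (rule pCK[OF y])
        \<comment> \<open>The summand \<open>a\<close> contracts to zero, and the sign left over is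
          absorbed by negating the contraction of \<open>y\<close>.\<close>
        have "?p i x = \<ominus>\<^bsub>?E\<^esub> ?b (?p i y) \<oplus>\<^bsub>?E\<^esub> \<zero>\<^bsub>?E\<^esub>"
          unfolding xa fc(2)[OF byE aE] pb[OF y] using CL_iff[OF aK] a i by simp
        also have "\<dots> = ?b (\<ominus>\<^bsub>?E\<^esub> ?p i y)"
          using E.linear_maps_minus[OF E boundary_linear Lk'(1)[OF pyL]] bnd(1)[OF Lk'(1)[OF pyL]]
          by simp
        finally show "?p i x \<in> ?b ` Lk i (d + 1)" using Lk'(3)[OF pyL] by blast
      qed
    qed
    finally show "q d x = \<zero>\<^bsub>?P d\<^esub> \<longleftrightarrow> (\<exists>y\<in>CK (d + 2). \<exists>a\<in>CL (d + 1). x = ?b y \<oplus>\<^bsub>?E\<^esub> a)" .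
  qed
  moreover have "reduced_homology R L = homology ?E ?b CL" "reduced_homology R K = homology ?E ?b CK"
    unfolding reduced_homology_eq by (simp_all add: CK_def[abs_def] CL_def[abs_def])
  ultimately show ?thesis unfolding L_def[symmetric] H_def[symmetric] by simp
qed

end

section \<open>The chessboard complex\<close>

lemma disjoint_ends_iff:
  "ends e \<inter> ends e' = {} \<longleftrightarrow> fst e \<noteq> fst e' \<and> snd e \<noteq> snd e'"
  by (cases e; cases e') auto

text \<open>The edges of the bipartite graph on \<open>S\<close> and \<open>T\<close> that are
  disjoint from \<open>(s, t)\<close> are precisely those of the graph with both end vertices
  removed.\<close>

lemma link_matching_complex:
  assumes "s \<in> S" and "t \<in> T"
  shows "link (matching_complex S T) (s, t) = matching_complex (S - {s}) (T - {t})"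
  using assms
  by (auto simp: link_def matching_complex_def pairwise_insert disjoint_ends_iff)

theorem theorem2p3:
  fixes F :: "('a, 'r) ring_scheme" and m n :: nat
  assumes "ring F" and "m \<ge> 1" and "n \<ge> 1"
  shows "\<exists>f g h. long_exact_sequence F
           (P_hat F m n)
           (reduced_homology F (Gamma m n))
           (reduced_homology F (matching_complex {1..m} {1..n}))
           f g h"
proof -
  interpret ring F by fact
  let ?M = "matching_complex {1..m} {1..n}"
  have "{1..n} - {1} = {2..n}" by auto
  then have link: "link ?M (s, 1) = matching_complex ({1..m} - {s}) {2..n}" if "s \<in> {3..m}" for s
    using link_matching_complex[of s "{1..m}" 1 "{1..n}"] that assms(3) by simp
  have "\<exists>f g h. long_exact_sequence F
    (\<lambda>d. direct_sum {3..m} (\<lambda>s. reduced_homology F (link ?M (s, 1)) d))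
    (reduced_homology F {\<sigma> \<in> ?M. \<forall>s\<in>{3..m}. (s, 1) \<notin> \<sigma>}) (reduced_homology F ?M) f g h"
  proof (rule deletion_long_exact_sequence)
    show "{(s, 1)} \<in> ?M" if "s \<in> {3..m}" for s
      using that assms(3) by (auto simp: matching_complex_def)
    \<comment> \<open>Two distinct edges \<open>(s, 1)\<close> and \<open>(s', 1)\<close> meet in
      the vertex \<open>Inr 1\<close>, so no matching contains both.\<close>
    show "s = s'" if "\<sigma> \<in> ?M" "(s, 1) \<in> \<sigma>" "(s', 1) \<in> \<sigma>" for \<sigma> s s'
    proof (rule ccontr)
      assume "s \<noteq> s'"
      have "pairwise (\<lambda>e e'. ends e \<inter> ends e' = {}) \<sigma>"
        using that(1) by (simp add: matching_complex_def)
      from pairwiseD(1)[OF this that(2,3)] \<open>s \<noteq> s'\<close> show False by simp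
    qed
  qed (simp_all add: simplicial_complex_matching_complex)
  moreover have "(\<lambda>d. direct_sum {3..m} (\<lambda>s. reduced_homology F (link ?M (s, 1)) d)) = P_hat F m n"
    unfolding P_hat_def by (intro ext direct_sum_cong) (simp only: link)
  ultimately show ?thesis by (simp add: Gamma_def)
qed

end
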